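(* Let $\bar{A}$ be an $m$-by-$n$ matrix with $m \geq n$, $\bar{b}$ an $m$-vector, and $\bar{c}$ an $n$-vector such that $\|\bar{A}\|, \|\bar{b}\|, \|\bar{c}\| \leq 1$. Let $A$, $b$ and $c$ be a Gaussian random matrix and two Gaussian random vectors of variance $\sigma^{2}$ centered at $\bar{A}$, $\bar{b}$ and $\bar{c}$, respectively. Then, for $\sigma^{2} \leq 1$, \[ \mathbb{E}\left[\max\left(1, \log\left(\frac{1}{\delta(A,b,c)}\right)\right)\right] \leq O(\log(m/\sigma)). \]
   Context: Linear programs are taken in the form: maximize $c x$ subject to $A x \leq b$, $x \geq 0$ (with $c$ a row $n$-vector, $b$ a column $m$-vector), with dual: minimize $y b$ subject to $y A \geq c$, $y \geq 0$. With probability 1 a feasible and bounded program has unique optimal primal and dual solutions $x^*$ and $y^*$; let $U = \{i : x^*_i > 0\}$ and $V = \{j : y^*_j > 0\}$. For an approximate primal solution $x$, let $U(x)$ and $V(x)$ be the index sets such that $\{x_i : i \notin U(x)\} \cup \{b_j - A_{j,:}x : j \in V(x)\}$ are the smallest $n$ values in $\{x_i\} \cup \{b_j - A_{j,:}x\}$ (the termination scheme guesses the optimum as the solution of $x_i = 0$ for $i \notin U(x)$ and $b_j - A_{j,:}x = 0$ for $j \in V(x)$). For a feasible and bounded program, $\delta(A,b,c)$ is the supremum of the $\delta$ such that $c x^* - c x < \delta$ implies $U(x) = U$ and $V(x) = V$; for unbounded or infeasible programs $\delta(A,b,c) = \infty$. Norms are Euclidean (operator 2-norm for matrices). *)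

theory Defs
  imports "HOL-Probability.Probability"
begin

text \<open>Data of a linear program with explicit dimensions: m constraints, n variables.
  A j i is the entry in row j < m, column i < n; b j (j < m); c i (i < n).
  Primal: maximize c x subject to A x <= b, x >= 0.
  Dual: minimize y b subject to y A >= c, y >= 0.\<close>

definition vec_norm :: "nat \<Rightarrow> (nat \<Rightarrow> real) \<Rightarrow> real" where
  "vec_norm k v = sqrt (\<Sum>i<k. (v i)\<^sup>2)"

definition mat_vec :: "nat \<Rightarrow> (nat \<Rightarrow> nat \<Rightarrow> real) \<Rightarrow> (nat \<Rightarrow> real) \<Rightarrow> (nat \<Rightarrow> real)" where
  "mat_vec n A x = (\<lambda>j. \<Sum>i<n. A j i * x i)"

definition mat_op_norm :: "nat \<Rightarrow> nat \<Rightarrow> (nat \<Rightarrow> nat \<Rightarrow> real) \<Rightarrow> real" where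
  "mat_op_norm m n A = (SUP x\<in>{x. vec_norm n x \<le> 1}. vec_norm m (mat_vec n A x))"

definition primal_feasible ::
  "nat \<Rightarrow> nat \<Rightarrow> (nat \<Rightarrow> nat \<Rightarrow> real) \<Rightarrow> (nat \<Rightarrow> real) \<Rightarrow> (nat \<Rightarrow> real) \<Rightarrow> bool" where
  "primal_feasible m n A b x \<longleftrightarrow>
     (\<forall>j<m. (\<Sum>i<n. A j i * x i) \<le> b j) \<and> (\<forall>i<n. 0 \<le> x i)"

definition objective :: "nat \<Rightarrow> (nat \<Rightarrow> real) \<Rightarrow> (nat \<Rightarrow> real) \<Rightarrow> real" where
  "objective n c x = (\<Sum>i<n. c i * x i)"

definition dual_feasible ::
  "nat \<Rightarrow> nat \<Rightarrow> (nat \<Rightarrow> nat \<Rightarrow> real) \<Rightarrow> (nat \<Rightarrow> real) \<Rightarrow> (nat \<Rightarrow> real) \<Rightarrow> bool" where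
  "dual_feasible m n A c y \<longleftrightarrow>
     (\<forall>i<n. c i \<le> (\<Sum>j<m. y j * A j i)) \<and> (\<forall>j<m. 0 \<le> y j)"

definition primal_opt ::
  "nat \<Rightarrow> nat \<Rightarrow> (nat \<Rightarrow> nat \<Rightarrow> real) \<Rightarrow> (nat \<Rightarrow> real) \<Rightarrow> (nat \<Rightarrow> real) \<Rightarrow> (nat \<Rightarrow> real) \<Rightarrow> bool" where
  "primal_opt m n A b c x \<longleftrightarrow> primal_feasible m n A b x \<and>
     (\<forall>x'. primal_feasible m n A b x' \<longrightarrow> objective n c x' \<le> objective n c x)"

definition dual_opt ::
  "nat \<Rightarrow> nat \<Rightarrow> (nat \<Rightarrow> nat \<Rightarrow> real) \<Rightarrow> (nat \<Rightarrow> real) \<Rightarrow> (nat \<Rightarrow> real) \<Rightarrow> (nat \<Rightarrow> real) \<Rightarrow> bool" where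
  "dual_opt m n A b c y \<longleftrightarrow> dual_feasible m n A c y \<and>
     (\<forall>y'. dual_feasible m n A c y' \<longrightarrow> objective m b y \<le> objective m b y')"

definition lp_feasible_bounded ::
  "nat \<Rightarrow> nat \<Rightarrow> (nat \<Rightarrow> nat \<Rightarrow> real) \<Rightarrow> (nat \<Rightarrow> real) \<Rightarrow> (nat \<Rightarrow> real) \<Rightarrow> bool" where
  "lp_feasible_bounded m n A b c \<longleftrightarrow> (\<exists>x. primal_feasible m n A b x) \<and>
     (\<exists>B. \<forall>x. primal_feasible m n A b x \<longrightarrow> objective n c x \<le> B)"

definition lp_unique_opt ::
  "nat \<Rightarrow> nat \<Rightarrow> (nat \<Rightarrow> nat \<Rightarrow> real) \<Rightarrow> (nat \<Rightarrow> real) \<Rightarrow> (nat \<Rightarrow> real) \<Rightarrow> bool" where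
  "lp_unique_opt m n A b c \<longleftrightarrow>
     (\<exists>x. primal_opt m n A b c x) \<and> (\<exists>y. dual_opt m n A b c y) \<and>
     (\<forall>x x'. primal_opt m n A b c x \<longrightarrow> primal_opt m n A b c x' \<longrightarrow> (\<forall>i<n. x i = x' i)) \<and>
     (\<forall>y y'. dual_opt m n A b c y \<longrightarrow> dual_opt m n A b c y' \<longrightarrow> (\<forall>j<m. y j = y' j))"

text \<open>The m+n values considered by the termination scheme: Inl i stands for x_i (i < n),
  Inr j stands for the slack b_j - A_j x (j < m).\<close>
definition scheme_index :: "nat \<Rightarrow> nat \<Rightarrow> (nat + nat) set" where
  "scheme_index m n = Inl ` {..<n} \<union> Inr ` {..<m}"

definition scheme_value ::
  "nat \<Rightarrow> (nat \<Rightarrow> nat \<Rightarrow> real) \<Rightarrow> (nat \<Rightarrow> real) \<Rightarrow> (nat \<Rightarrow> real) \<Rightarrow> nat + nat \<Rightarrow> real" where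
  "scheme_value n A b x k = (case k of Inl i \<Rightarrow> x i | Inr j \<Rightarrow> b j - (\<Sum>i<n. A j i * x i))"

definition smallest_n ::
  "nat \<Rightarrow> nat \<Rightarrow> (nat \<Rightarrow> nat \<Rightarrow> real) \<Rightarrow> (nat \<Rightarrow> real) \<Rightarrow> (nat \<Rightarrow> real) \<Rightarrow> (nat + nat) set \<Rightarrow> bool" where
  "smallest_n m n A b x S \<longleftrightarrow> S \<subseteq> scheme_index m n \<and> card S = n \<and>
     (\<forall>s\<in>S. \<forall>t\<in>scheme_index m n - S. scheme_value n A b x s \<le> scheme_value n A b x t)"

text \<open>U(x) = U and V(x) = V: every admissible choice of the n smallest values
  yields exactly the index sets U and V.\<close>
definition guess_correct ::
  "nat \<Rightarrow> nat \<Rightarrow> (nat \<Rightarrow> nat \<Rightarrow> real) \<Rightarrow> (nat \<Rightarrow> real) \<Rightarrow> (nat \<Rightarrow> real) \<Rightarrow> nat set \<Rightarrow> nat set \<Rightarrow> bool" where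
  "guess_correct m n A b x U V \<longleftrightarrow>
     (\<forall>S. smallest_n m n A b x S \<longrightarrow>
        {i. i < n \<and> Inl i \<notin> S} = U \<and> {j. j < m \<and> Inr j \<in> S} = V)"

text \<open>delta(A,b,c). For feasible bounded programs with unique optima x*, y*, it is the supremum
  of the d such that every feasible x with c x* - c x < d has U(x) = U and V(x) = V.
  Infeasible or unbounded: infinity. The (probability zero) degenerate case of non-unique
  optima is assigned 0.\<close>
definition lp_delta ::
  "nat \<Rightarrow> nat \<Rightarrow> (nat \<Rightarrow> nat \<Rightarrow> real) \<Rightarrow> (nat \<Rightarrow> real) \<Rightarrow> (nat \<Rightarrow> real) \<Rightarrow> ereal" where
  "lp_delta m n A b c =
     (if \<not> lp_feasible_bounded m n A b c then \<infinity>
      else if \<not> lp_unique_opt m n A b c then 0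
      else Sup {ereal d | d. \<forall>xs ys. primal_opt m n A b c xs \<longrightarrow> dual_opt m n A b c ys \<longrightarrow>
              (\<forall>x. primal_feasible m n A b x \<longrightarrow> objective n c xs - objective n c x < d \<longrightarrow>
                 guess_correct m n A b x {i. i < n \<and> 0 < xs i} {j. j < m \<and> 0 < ys j})})"

definition lp_cost ::
  "nat \<Rightarrow> nat \<Rightarrow> (nat \<Rightarrow> nat \<Rightarrow> real) \<Rightarrow> (nat \<Rightarrow> real) \<Rightarrow> (nat \<Rightarrow> real) \<Rightarrow> ennreal" where
  "lp_cost m n A b c =
     (let d = lp_delta m n A b c in
      if d = \<infinity> then 1
      else if d \<le> 0 then \<infinity>
      else ennreal (max 1 (ln (1 / real_of_ereal d))))"

definition gauss :: "real \<Rightarrow> real \<Rightarrow> real measure" where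
  "gauss mu sd = density lborel (normal_density mu sd)"

definition smoothed_measure ::
  "nat \<Rightarrow> nat \<Rightarrow> (nat \<Rightarrow> nat \<Rightarrow> real) \<Rightarrow> (nat \<Rightarrow> real) \<Rightarrow> (nat \<Rightarrow> real) \<Rightarrow> real
   \<Rightarrow> ((nat \<times> nat \<Rightarrow> real) \<times> (nat \<Rightarrow> real) \<times> (nat \<Rightarrow> real)) measure" where
  "smoothed_measure m n Abar bbar cbar sd =
     (PiM ({..<m} \<times> {..<n}) (\<lambda>(j, i). gauss (Abar j i) sd)) \<Otimes>\<^sub>M
     ((PiM {..<m} (\<lambda>j. gauss (bbar j) sd)) \<Otimes>\<^sub>M (PiM {..<n} (\<lambda>i. gauss (cbar i) sd)))"

end

theory Submission
  imports Defs
begin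

text \<open>For fixed \<open>A\<close>, the randomness of \<open>b\<close> and \<open>c\<close> suffices. Put \<open>\<tau> = sqrt \<epsilon>\<close>. The \<open>n\<close> smallest values at any
  \<open>\<epsilon>\<close>-optimal point give the right guess as soon as the primal and dual optima are unique, every value
  with a vanishing dual counterpart exceeds \<open>2 \<tau>\<close> at the optimum, and no value takes both the levels
  \<open>0\<close> and \<open>\<tau>\<close>, or both \<open>\<tau>\<close> and \<open>2 \<tau>\<close>, on \<open>\<epsilon>\<close>-optimal points: uniqueness makes at least \<open>n\<close> primal and at
  least \<open>m\<close> dual values vanish, so strict complementarity leaves exactly \<open>n\<close> vanishing primal values,
  and these stay below \<open>\<tau>\<close> while all others stay above \<open>\<tau>\<close>.

  Each exceptional event recurs only briefly along a line. If a value is at least \<open>q\<close> at some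
  \<open>\<epsilon>\<close>-optimal point for \<open>c\<close> and at most \<open>p\<close> at some \<open>\<epsilon>\<close>-optimal point for \<open>c + s v\<close>, where \<open>v\<close> is the
  gradient of that value, then \<open>s (q - p) \<le> 2 \<epsilon>\<close>; relaxing by \<open>s\<close> a constraint whose dual value vanishes raises
  its slack at the optimum to at least \<open>s\<close>. A Gaussian vector falls with probability at most
  \<open>2 l \<bar>v\<bar> / \<sigma>\<close> into a set that is disjoint from its translates by \<open>s v\<close> for all \<open>s \<ge> l\<close>. Hence \<open>\<delta> < \<epsilon>\<close> has
  probability \<open>O(m\<^sup>3 sqrt \<epsilon> / \<sigma>)\<close>, and summing over \<open>\<epsilon> = exp (- k)\<close> gives the bound.\<close>

section \<open>Linear programming duality\<close>

text \<open>A pair \<open>(a, \<beta>)\<close> encodes the inequality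
  \<open>a x \<le> \<beta>\<close>. Generating the consequences inductively lets elimination steps
  be composed by plain transitivity; explicit multipliers are recovered only at the end.\<close>

inductive_set nonneg_combinations :: "((nat \<Rightarrow> real) \<times> real) set \<Rightarrow> ((nat \<Rightarrow> real) \<times> real) set"
  for F where
  base: "f \<in> F \<Longrightarrow> f \<in> nonneg_combinations F"
| zero: "((\<lambda>_. 0), 0) \<in> nonneg_combinations F"
| add: "(a, \<beta>) \<in> nonneg_combinations F \<Longrightarrow> (a', \<beta>') \<in> nonneg_combinations F
    \<Longrightarrow> ((\<lambda>i. a i + a' i), \<beta> + \<beta>') \<in> nonneg_combinations F"
| scale: "(a, \<beta>) \<in> nonneg_combinations F \<Longrightarrow> 0 \<le> r \<Longrightarrow> ((\<lambda>i. r * a i), r * \<beta>) \<in> nonneg_combinations F"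

lemma nonneg_combinations_trans:
  assumes "f \<in> nonneg_combinations G" "G \<subseteq> nonneg_combinations F"
  shows "f \<in> nonneg_combinations F"
  using assms
  by (induction rule: nonneg_combinations.induct) (auto intro: nonneg_combinations.intros)

lemma nonneg_combinations_coeff_zero:
  assumes "f \<in> nonneg_combinations F" "\<And>g. g \<in> F \<Longrightarrow> fst g i = 0"
  shows "fst f i = 0"
  using assms by (induction rule: nonneg_combinations.induct) auto

text \<open>Recovers explicit multipliers from a derivation. Several indices may carry the same
  inequality, so the base case puts its whole weight on one of them.\<close>

lemma nonneg_combinations_image:
  assumes "f \<in> nonneg_combinations ((\<lambda>k. (a k, \<beta> k)) ` I)" "finite I"
  shows "\<exists>w. (\<forall>k\<in>I. 0 \<le> w k) \<and> (\<forall>i. fst f i = (\<Sum>k\<in>I. w k * a k i)) \<and> snd f = (\<Sum>k\<in>I. w k * \<beta> k)"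
  using assms(1)
proof (induction rule: nonneg_combinations.induct)
  case (base f)
  then obtain k where k: "k \<in> I" "f = (a k, \<beta> k)" by auto
  have "(\<Sum>j\<in>I. of_bool (j = k) * g j) = (g k :: real)" for g
    using k assms(2) by (simp add: of_bool_def if_distrib[of "\<lambda>x. x * _"] cong: if_cong)
  then show ?case
    using k by (intro exI[of _ "\<lambda>j. of_bool (j = k)"]) auto
next
  case zero
  show ?case by (intro exI[of _ "\<lambda>_. 0"]) auto
next
  case (add a1 b1 a2 b2)
  then obtain w1 w2 where
    "(\<forall>k\<in>I. 0 \<le> w1 k) \<and> (\<forall>i. a1 i = (\<Sum>k\<in>I. w1 k * a k i)) \<and> b1 = (\<Sum>k\<in>I. w1 k * \<beta> k)"
    "(\<forall>k\<in>I. 0 \<le> w2 k) \<and> (\<forall>i. a2 i = (\<Sum>k\<in>I. w2 k * a k i)) \<and> b2 = (\<Sum>k\<in>I. w2 k * \<beta> k)"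
    by auto
  then show ?case
    by (intro exI[of _ "\<lambda>k. w1 k + w2 k"]) (auto simp: distrib_right sum.distrib)
next
  case (scale a1 b1 r)
  then obtain w1 where
    "(\<forall>k\<in>I. 0 \<le> w1 k) \<and> (\<forall>i. a1 i = (\<Sum>k\<in>I. w1 k * a k i)) \<and> b1 = (\<Sum>k\<in>I. w1 k * \<beta> k)"
    by auto
  then show ?case using scale(2)
    by (intro exI[of _ "\<lambda>k. r * w1 k"]) (auto simp: sum_distrib_left mult.assoc)
qed

text \<open>Supplies the value of an eliminated variable between the finitely many lower and upper
  bounds that remain for it.\<close>

lemma separating_real_exists:
  fixes L U :: "real set"
  assumes "finite L" "finite U" "\<And>l u. l \<in> L \<Longrightarrow> u \<in> U \<Longrightarrow> l \<le> u"
  shows "\<exists>t. (\<forall>l\<in>L. l \<le> t) \<and> (\<forall>u\<in>U. t \<le> u)"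
proof (cases "L = {}")
  case True
  then show ?thesis
    using assms(2) by (cases "U = {}") (auto intro!: exI[of _ "Min U"])
next
  case False
  then show ?thesis
    using assms by (intro exI[of _ "Max L"]) auto
qed

text \<open>Fourier--Motzkin elimination of the last variable: an inequality with positive last coefficient
  and one with negative last coefficient are combined so that this coefficient cancels.\<close>
lemma farkas_alternative:
  assumes "finite F"
  shows "(\<exists>x. \<forall>f\<in>F. (\<Sum>i<n. fst f i * x i) \<le> snd f)
    \<or> (\<exists>f\<in>nonneg_combinations F. (\<forall>i<n. fst f i = 0) \<and> snd f < 0)"
  using assms
proof (induction n arbitrary: F)
  case 0
  show ?case
    using nonneg_combinations.base[of _ F] by (cases "\<forall>f\<in>F. 0 \<le> snd f") force+
next
  case (Suc n)
  define P where "P = {f\<in>F. 0 < fst f n}"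
  define N where "N = {f\<in>F. fst f n < 0}"
  define comb :: "((nat \<Rightarrow> real) \<times> real) \<times> ((nat \<Rightarrow> real) \<times> real) \<Rightarrow> (nat \<Rightarrow> real) \<times> real"
    where "comb = (\<lambda>(f, g). (\<lambda>i. inverse (fst f n) * fst f i + inverse (- fst g n) * fst g i,
      inverse (fst f n) * snd f + inverse (- fst g n) * snd g))"
  define G where "G = {f\<in>F. fst f n = 0} \<union> comb ` (P \<times> N)"
  have fin: "finite P" "finite N" "finite G"
    using Suc.prems by (auto simp: P_def N_def G_def)
  have "comb (f, g) \<in> nonneg_combinations F" if "f \<in> P" "g \<in> N" for f g
    unfolding comb_def prod.case using that
    by (intro nonneg_combinations.add nonneg_combinations.scale)
       (auto simp: P_def N_def intro: nonneg_combinations.base)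
  then have sub: "G \<subseteq> nonneg_combinations F"
    by (auto simp: G_def intro: nonneg_combinations.base)
  have G0: "fst f n = 0" if "f \<in> G" for f
    using that by (auto simp: G_def comb_def P_def N_def nonzero_inverse_minus_eq)
  from Suc.IH[OF fin(3)] show ?case
  proof
    assume "\<exists>x. \<forall>f\<in>G. (\<Sum>i<n. fst f i * x i) \<le> snd f"
    then obtain x where x: "\<And>f. f \<in> G \<Longrightarrow> (\<Sum>i<n. fst f i * x i) \<le> snd f" by blast
    define s :: "(nat \<Rightarrow> real) \<times> real \<Rightarrow> real" where "s = (\<lambda>f. (\<Sum>i<n. fst f i * x i))"
    \<comment> \<open>Once the other unknowns are fixed, \<open>lim f\<close> is the bound that
      \<open>f\<close> puts on the last one: from above for \<open>f \<in> P\<close>, from below for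
      \<open>f \<in> N\<close>.\<close>
    define lim where "lim = (\<lambda>f. (snd f - s f) / fst f n)"
    have "lim g \<le> lim f" if "f \<in> P" "g \<in> N" for f g
    proof -
      have "comb (f, g) \<in> G" using that by (auto simp: G_def)
      from x[OF this] have "inverse (fst f n) * s f + inverse (- fst g n) * s g
          \<le> inverse (fst f n) * snd f + inverse (- fst g n) * snd g"
        by (simp add: comb_def s_def algebra_simps sum.distrib sum_subtractf sum_negf sum_distrib_left nonzero_inverse_minus_eq)
      then show ?thesis
        by (simp add: lim_def divide_inverse algebra_simps nonzero_inverse_minus_eq)
    qed
    then have "\<exists>t. (\<forall>l\<in>lim ` N. l \<le> t) \<and> (\<forall>u\<in>lim ` P. t \<le> u)"
      using fin by (intro separating_real_exists) blast+
    then obtain t where t: "\<And>g. g \<in> N \<Longrightarrow> lim g \<le> t" "\<And>f. f \<in> P \<Longrightarrow> t \<le> lim f"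
      by blast
    have "(\<Sum>i<Suc n. fst f i * (x(n := t)) i) \<le> snd f" if "f \<in> F" for f
    proof -
      have eq: "(\<Sum>i<Suc n. fst f i * (x(n := t)) i) = s f + fst f n * t"
        by (simp add: s_def)
      consider "fst f n = 0" | "f \<in> P" | "f \<in> N"
        using \<open>f \<in> F\<close> by (force simp: P_def N_def)
      then show ?thesis
      proof cases
        case 1
        then show ?thesis using x[of f] that eq by (simp add: G_def s_def)
      next
        case 2
        then show ?thesis using t(2)[of f] eq
          by (simp add: P_def lim_def pos_le_divide_eq algebra_simps)
      next
        case 3
        then show ?thesis using t(1)[of f] eq
          by (simp add: N_def lim_def neg_divide_le_eq algebra_simps)
      qed
    qed
    then show ?thesis by blast
  next
    assume "\<exists>f\<in>nonneg_combinations G. (\<forall>i<n. fst f i = 0) \<and> snd f < 0"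
    then obtain f where f: "f \<in> nonneg_combinations G" "\<And>i. i < n \<Longrightarrow> fst f i = 0" "snd f < 0"
      by blast
    \<comment> \<open>No member of \<open>G\<close> contains the last variable, so a certificate for
      the first \<open>n\<close> unknowns is one for all \<open>Suc n\<close>.\<close>
    then have "fst f i = 0" if "i < Suc n" for i
      using that nonneg_combinations_coeff_zero[OF f(1) G0] by (cases "i = n") auto
    then show ?thesis
      using nonneg_combinations_trans[OF f(1) sub] f(3) by blast
  qed
qed

lemma farkas:
  fixes a :: "'k \<Rightarrow> nat \<Rightarrow> real"
  assumes "finite I" and "\<not> (\<exists>x. \<forall>k\<in>I. (\<Sum>i<n. a k i * x i) \<le> \<beta> k)"
  shows "\<exists>w. (\<forall>k\<in>I. 0 \<le> w k) \<and> (\<forall>i<n. (\<Sum>k\<in>I. w k * a k i) = 0) \<and> (\<Sum>k\<in>I. w k * \<beta> k) < 0"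
proof -
  let ?F = "(\<lambda>k. (a k, \<beta> k)) ` I"
  from assms have "\<exists>f\<in>nonneg_combinations ?F. (\<forall>i<n. fst f i = 0) \<and> snd f < 0"
    using farkas_alternative[of ?F n] by force
  then obtain f where f: "f \<in> nonneg_combinations ?F" "\<forall>i<n. fst f i = 0" "snd f < 0" by blast
  from nonneg_combinations_image[OF f(1) assms(1)] f(2,3) show ?thesis by auto
qed

section \<open>Weak and strong duality\<close>

lemma double_sum_swap:
  fixes A :: "nat \<Rightarrow> nat \<Rightarrow> real"
  shows "(\<Sum>i<n. (\<Sum>j<m. y j * A j i) * x i) = (\<Sum>j<m. y j * (\<Sum>i<n. A j i * x i))"
  by (simp add: sum_distrib_left sum_distrib_right mult.assoc) (rule sum.swap)

lemma weak_duality: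
  assumes "primal_feasible m n A b x" "dual_feasible m n A c y"
  shows "objective n c x \<le> objective m b y"
proof -
  have "objective n c x \<le> (\<Sum>i<n. (\<Sum>j<m. y j * A j i) * x i)"
    using assms unfolding objective_def primal_feasible_def dual_feasible_def
    by (intro sum_mono mult_right_mono) auto
  also have "\<dots> = (\<Sum>j<m. y j * (\<Sum>i<n. A j i * x i))" by (rule double_sum_swap)
  also have "\<dots> \<le> (\<Sum>j<m. y j * b j)"
    using assms unfolding primal_feasible_def dual_feasible_def
    by (intro sum_mono mult_left_mono) auto
  finally show ?thesis by (simp add: objective_def mult.commute)
qed

text \<open>Farkas' lemma for the system in the \<open>n + m\<close> unknowns \<open>(x, y)\<close> that says that \<open>x\<close> and \<open>y\<close> are
  feasible and that \<open>y b \<le> c x\<close>. In an infeasibility certificate, \<open>u\<close> and \<open>w\<close> are the multipliers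
  of \<open>A x \<le> b\<close> and \<open>y A \<ge> c\<close>, and \<open>\<kappa>\<close> is the multiplier of \<open>y b \<le> c x\<close>.\<close>
lemma duality_certificate:
  assumes "\<not> (\<exists>x y. primal_feasible m n A b x \<and> dual_feasible m n A c y \<and> objective m b y \<le> objective n c x)"
  shows "\<exists>u w \<kappa>. 0 \<le> (\<kappa>::real) \<and> (\<forall>j<m. 0 \<le> u j) \<and> (\<forall>i<n. 0 \<le> w i)
    \<and> (\<forall>i<n. \<kappa> * c i \<le> (\<Sum>j<m. u j * A j i)) \<and> (\<forall>j<m. (\<Sum>i<n. A j i * w i) \<le> \<kappa> * b j)
    \<and> objective m b u < objective n c w"
proof -
  \<comment> \<open>Unknown \<open>l < n\<close> is \<open>x l\<close>, and unknown
    \<open>n + j\<close> is \<open>y j\<close>. \<open>None\<close> indexes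
    \<open>y b \<le> c x\<close>; the outer \<open>Inl\<close> and \<open>Inr\<close> mark primal
    and dual constraints, in which the inner \<open>Inl\<close> marks rows or columns of
    \<open>A\<close> and the inner \<open>Inr\<close> marks sign constraints.\<close>
  define I :: "((nat + nat) + (nat + nat)) option set" where
    "I = insert None (Some ` ((Inl ` (Inl ` {..<m} \<union> Inr ` {..<n})) \<union> (Inr ` (Inl ` {..<n} \<union> Inr ` {..<m}))))"
  define a :: "((nat + nat) + (nat + nat)) option \<Rightarrow> nat \<Rightarrow> real" where "a = (\<lambda>k l. case k of
      None \<Rightarrow> if l < n then - c l else b (l - n)
    | Some (Inl (Inl j)) \<Rightarrow> if l < n then A j l else 0
    | Some (Inl (Inr i)) \<Rightarrow> if l = i then - 1 else 0
    | Some (Inr (Inl i)) \<Rightarrow> if l < n then 0 else - A (l - n) i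
    | Some (Inr (Inr j)) \<Rightarrow> if l = n + j then - 1 else (0::real))"
  define \<beta> :: "((nat + nat) + (nat + nat)) option \<Rightarrow> real" where "\<beta> = (\<lambda>k. case k of
      None \<Rightarrow> 0
    | Some (Inl (Inl j)) \<Rightarrow> b j
    | Some (Inl (Inr i)) \<Rightarrow> 0
    | Some (Inr (Inl i)) \<Rightarrow> - c i
    | Some (Inr (Inr j)) \<Rightarrow> (0::real))"
  have sumI: "(\<Sum>k\<in>I. g k) = g None + (\<Sum>j<m. g (Some (Inl (Inl j)))) + (\<Sum>i<n. g (Some (Inl (Inr i))))
      + (\<Sum>i<n. g (Some (Inr (Inl i)))) + (\<Sum>j<m. g (Some (Inr (Inr j))))" for g :: "_ \<Rightarrow> real"
  proof -
    let ?a = "(\<lambda>j. Some (Inl (Inl j))) ` {..<m}" and ?b = "(\<lambda>i. Some (Inl (Inr i))) ` {..<n}"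
    let ?c = "(\<lambda>i. Some (Inr (Inl i))) ` {..<n}" and ?d = "(\<lambda>j. Some (Inr (Inr j))) ` {..<m}"
    have "I = insert None ((?a \<union> ?b) \<union> (?c \<union> ?d))"
      by (simp add: I_def image_Un image_image)
    then have "sum g I = g None + sum g ((?a \<union> ?b) \<union> (?c \<union> ?d))"
      by (simp, subst sum.insert) auto
    also have "sum g ((?a \<union> ?b) \<union> (?c \<union> ?d)) = sum g (?a \<union> ?b) + sum g (?c \<union> ?d)"
      by (intro sum.union_disjoint) auto
    also have "sum g (?a \<union> ?b) = sum g ?a + sum g ?b" by (intro sum.union_disjoint) auto
    also have "sum g (?c \<union> ?d) = sum g ?c + sum g ?d" by (intro sum.union_disjoint) auto
    finally show ?thesis by (simp add: sum.reindex inj_on_def)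
  qed
  have sumnm: "(\<Sum>l<n + m. g l) = (\<Sum>i<n. g i) + (\<Sum>j<m. g (n + j))" for g :: "nat \<Rightarrow> real"
    by (induction m) auto
  have delta: "(\<Sum>l<N. (if l = i then - 1 else 0) * z l) = - z i" if "i < N" for N i and z :: "nat \<Rightarrow> real"
    using that by (simp add: if_distrib[of "\<lambda>x. x * _"] cong: if_cong)
  have "\<not> (\<exists>z. \<forall>k\<in>I. (\<Sum>l<n + m. a k l * z l) \<le> \<beta> k)"
  proof
    assume "\<exists>z. \<forall>k\<in>I. (\<Sum>l<n + m. a k l * z l) \<le> \<beta> k"
    then obtain z where z: "\<And>k. k \<in> I \<Longrightarrow> (\<Sum>l<n + m. a k l * z l) \<le> \<beta> k" by blast
    define y where "y = (\<lambda>j. z (n + j))"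
    have "primal_feasible m n A b z"
      unfolding primal_feasible_def
    proof (intro conjI allI impI)
      fix j assume "j < m"
      then show "(\<Sum>i<n. A j i * z i) \<le> b j"
        using z[of "Some (Inl (Inl j))"] by (simp add: I_def a_def \<beta>_def sumnm)
    next
      fix i assume "i < n"
      then show "0 \<le> z i"
        using z[of "Some (Inl (Inr i))"] delta[of i "n + m" z] by (auto simp: I_def a_def \<beta>_def)
    qed
    moreover have "dual_feasible m n A c y"
      unfolding dual_feasible_def
    proof (intro conjI allI impI)
      fix i assume "i < n"
      then show "c i \<le> (\<Sum>j<m. y j * A j i)"
        using z[of "Some (Inr (Inl i))"]
        by (simp add: I_def a_def \<beta>_def sumnm y_def sum_negf mult.commute)
    next
      fix j assume "j < m"
      then show "0 \<le> y j"
        using z[of "Some (Inr (Inr j))"] delta[of "n + j" "n + m" z]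
        by (auto simp: I_def a_def \<beta>_def y_def)
    qed
    moreover have "objective m b y \<le> objective n c z"
      using z[of None] by (simp add: I_def a_def \<beta>_def sumnm y_def sum_negf objective_def)
    ultimately show False using assms by blast
  qed
  moreover have "finite I" by (simp add: I_def)
  ultimately obtain \<omega> where \<omega>: "\<And>k. k \<in> I \<Longrightarrow> 0 \<le> \<omega> k"
    "\<And>l. l < n + m \<Longrightarrow> (\<Sum>k\<in>I. \<omega> k * a k l) = 0" "(\<Sum>k\<in>I. \<omega> k * \<beta> k) < 0"
    using farkas[where I = I and n = "n + m" and a = a and \<beta> = \<beta>] by blast
  define u where "u = (\<lambda>j. \<omega> (Some (Inl (Inl j))))"
  define w where "w = (\<lambda>i. \<omega> (Some (Inr (Inl i))))"
  have delta2: "(\<Sum>i<N. z i * (if l = i then - 1 else 0)) = - z l" if "l < N" for N l and z :: "nat \<Rightarrow> real"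
    using that by (simp add: if_distrib[of "\<lambda>x. _ * x"] cong: if_cong)
  have "0 \<le> \<omega> None" "\<forall>j<m. 0 \<le> u j" "\<forall>i<n. 0 \<le> w i"
    using \<omega>(1) by (auto simp: u_def w_def I_def)
  moreover have "\<omega> None * c i \<le> (\<Sum>j<m. u j * A j i)" if "i < n" for i
  proof -
    have "0 \<le> \<omega> (Some (Inl (Inr i)))" using that by (intro \<omega>(1)) (auto simp: I_def)
    moreover have "(\<Sum>j<m. \<omega> (Some (Inr (Inr j))) * (if i = n + j then - 1 else 0)) = 0"
      using that by (intro sum.neutral) auto
    ultimately show ?thesis
      using \<omega>(2)[of i] that delta2[of i n "\<lambda>i. \<omega> (Some (Inl (Inr i)))"]
      by (simp add: sumI a_def u_def)
  qed
  moreover have "(\<Sum>i<n. A j i * w i) \<le> \<omega> None * b j" if "j < m" for j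
  proof -
    have "0 \<le> \<omega> (Some (Inr (Inr j)))" using that by (intro \<omega>(1)) (auto simp: I_def)
    moreover have "(\<Sum>i<n. \<omega> (Some (Inl (Inr i))) * (if n + j = i then - 1 else 0)) = 0"
      by (intro sum.neutral) auto
    ultimately show ?thesis
      using \<omega>(2)[of "n + j"] that delta2[of j m "\<lambda>j. \<omega> (Some (Inr (Inr j)))"]
      by (simp add: sumI a_def w_def sum_negf mult.commute)
  qed
  moreover have "objective m b u < objective n c w"
    using \<omega>(3) by (simp add: sumI \<beta>_def objective_def u_def w_def sum_negf mult.commute)
  ultimately show ?thesis by blast
qed

text \<open>If no feasible pair closes the gap, there is a certificate. With
  \<open>\<kappa> > 0\<close> it rescales to a feasible pair that violates weak duality; with
  \<open>\<kappa> = 0\<close> it yields a feasible ray of growing objective, against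
  boundedness.\<close>

lemma strong_duality:
  assumes "lp_feasible_bounded m n A b c"
  shows "\<exists>x y. primal_feasible m n A b x \<and> dual_feasible m n A c y \<and> objective m b y = objective n c x"
proof -
  obtain x0 B where x0: "primal_feasible m n A b x0"
    and B: "\<And>x. primal_feasible m n A b x \<Longrightarrow> objective n c x \<le> B"
    using assms unfolding lp_feasible_bounded_def by blast
  have "\<exists>x y. primal_feasible m n A b x \<and> dual_feasible m n A c y \<and> objective m b y \<le> objective n c x"
  proof (rule ccontr)
    assume "\<not> ?thesis"
    from duality_certificate[OF this] obtain u w \<kappa> where
      \<kappa>: "0 \<le> (\<kappa>::real)" and u: "\<And>j. j < m \<Longrightarrow> 0 \<le> u j" and w: "\<And>i. i < n \<Longrightarrow> 0 \<le> w i"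
      and uA: "\<And>i. i < n \<Longrightarrow> \<kappa> * c i \<le> (\<Sum>j<m. u j * A j i)"
      and Aw: "\<And>j. j < m \<Longrightarrow> (\<Sum>i<n. A j i * w i) \<le> \<kappa> * b j"
      and lt: "objective m b u < objective n c w" by blast
    show False
    proof (cases "\<kappa> = 0")
      case False
      then have pos: "0 < \<kappa>" using \<kappa> by simp
      have "(\<Sum>i<n. A j i * (w i / \<kappa>)) \<le> b j" if "j < m" for j
        using Aw[OF that] pos
        by (simp add: sum_divide_distrib[symmetric] pos_divide_le_eq mult.commute)
      then have "primal_feasible m n A b (\<lambda>i. w i / \<kappa>)"
        using w pos by (auto simp: primal_feasible_def)
      moreover have "c i \<le> (\<Sum>j<m. u j / \<kappa> * A j i)" if "i < n" for i
        using uA[OF that] pos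
        by (simp add: sum_divide_distrib[symmetric] pos_le_divide_eq mult.commute)
      then have "dual_feasible m n A c (\<lambda>j. u j / \<kappa>)"
        using u pos by (auto simp: dual_feasible_def)
      ultimately have "objective n c (\<lambda>i. w i / \<kappa>) \<le> objective m b (\<lambda>j. u j / \<kappa>)"
        by (rule weak_duality)
      then show False
        using lt pos by (simp add: objective_def sum_divide_distrib[symmetric] divide_le_cancel)
    next
      case True
      \<comment> \<open>Testing \<open>u\<close> against the feasible point \<open>x0\<close> gives
        \<open>0 \<le> u b\<close>, and hence \<open>0 < c w\<close>.\<close>
      have "0 \<le> (\<Sum>i<n. (\<Sum>j<m. u j * A j i) * x0 i)"
      proof (rule sum_nonneg, rule mult_nonneg_nonneg)
        fix i assume "i \<in> {..<n}"
        then show "0 \<le> (\<Sum>j<m. u j * A j i)" "0 \<le> x0 i"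
          using x0 uA[of i] True by (auto simp: primal_feasible_def)
      qed
      also have "\<dots> = (\<Sum>j<m. u j * (\<Sum>i<n. A j i * x0 i))" by (rule double_sum_swap)
      also have "\<dots> \<le> (\<Sum>j<m. u j * b j)"
        using x0 u by (intro sum_mono mult_left_mono) (auto simp: primal_feasible_def)
      finally have "0 < objective n c w"
        using lt by (simp add: objective_def mult.commute)
      \<comment> \<open>Far enough along the ray for the objective at \<open>x0 + t w\<close> to
        exceed \<open>B\<close>.\<close>
      define t where "t = (\<bar>B\<bar> + \<bar>objective n c x0\<bar> + 1) / objective n c w"
      have t: "0 \<le> t" using \<open>0 < objective n c w\<close> by (simp add: t_def)
      have "(\<Sum>i<n. A j i * (x0 i + t * w i)) \<le> b j" if "j < m" for j
      proof -
        have "(\<Sum>i<n. A j i * (x0 i + t * w i)) = (\<Sum>i<n. A j i * x0 i) + t * (\<Sum>i<n. A j i * w i)"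
          by (simp add: algebra_simps sum.distrib sum_distrib_left)
        also have "\<dots> \<le> b j + t * 0"
          using x0 Aw[OF that] that t True
          by (intro add_mono mult_left_mono) (auto simp: primal_feasible_def)
        finally show ?thesis by simp
      qed
      then have "primal_feasible m n A b (\<lambda>i. x0 i + t * w i)"
        using x0 w t by (auto simp: primal_feasible_def)
      then have "objective n c (\<lambda>i. x0 i + t * w i) \<le> B" by (rule B)
      moreover have "objective n c (\<lambda>i. x0 i + t * w i) = objective n c x0 + t * objective n c w"
        by (simp add: objective_def algebra_simps sum.distrib sum_distrib_left)
      moreover have "t * objective n c w = \<bar>B\<bar> + \<bar>objective n c x0\<bar> + 1"
        using \<open>0 < objective n c w\<close> by (simp add: t_def)
      ultimately show False by linarith
    qed
  qed
  then show ?thesis using weak_duality by (meson antisym)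
qed

text \<open>Gaussian elimination: an equation with a nonzero coefficient at \<open>p\<close>
  determines the unknown \<open>p\<close> from the others and is subtracted from the remaining
  equations, which leaves one equation and one unknown less.\<close>

lemma homogeneous_system_nontrivial:
  fixes f :: "'k \<Rightarrow> 'v \<Rightarrow> real"
  assumes "finite B" "finite J" "card B < card J"
  shows "\<exists>d. (\<exists>i\<in>J. d i \<noteq> 0) \<and> (\<forall>k\<in>B. (\<Sum>i\<in>J. f k i * d i) = 0)"
  using assms
proof (induction B arbitrary: J f rule: finite_induct)
  case empty
  then obtain i where "i \<in> J" by fastforce
  then show ?case by (intro exI[of _ "\<lambda>_. 1"]) auto
next
  case (insert k B)
  show ?case
  proof (cases "\<forall>i\<in>J. f k i = 0")
    case True
    with insert show ?thesis by fastforce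
  next
    case False
    then obtain p where p: "p \<in> J" "f k p \<noteq> 0" by blast
    define g where "g = (\<lambda>h i. f h i - f h p * f k i / f k p)"
    have "card B < card (J - {p})"
      using insert p by (simp add: card_Diff_singleton)
    with insert.IH[of "J - {p}" g] insert.prems obtain d where
      d: "\<exists>i\<in>J - {p}. d i \<noteq> 0" "\<And>h. h \<in> B \<Longrightarrow> (\<Sum>i\<in>J - {p}. g h i * d i) = 0" by blast
    define e where "e = d(p := - (\<Sum>i\<in>J - {p}. f k i * d i) / f k p)"
    have split: "(\<Sum>i\<in>J. f h i * e i) = f h p * e p + (\<Sum>i\<in>J - {p}. f h i * d i)" for h
      using p insert.prems by (simp add: sum.remove[of J p] e_def)
    have "(\<Sum>i\<in>J. f k i * e i) = 0"
      using p by (simp add: split) (simp add: e_def)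
    moreover have "(\<Sum>i\<in>J. f h i * e i) = 0" if "h \<in> B" for h
    proof -
      have "(\<Sum>i\<in>J - {p}. f h i * d i) = f h p / f k p * (\<Sum>i\<in>J - {p}. f k i * d i)"
        using d(2)[OF that] by (simp add: g_def left_diff_distrib sum_subtractf sum_distrib_left algebra_simps)
      then show ?thesis by (simp add: split) (simp add: e_def)
    qed
    moreover have "\<exists>i\<in>J. e i \<noteq> 0" using d(1) by (auto simp: e_def)
    ultimately show ?thesis by (metis insert_iff)
  qed
qed

section \<open>Stability of the termination scheme\<close>

definition slack_gradient :: "(nat \<Rightarrow> nat \<Rightarrow> real) \<Rightarrow> nat + nat \<Rightarrow> nat \<Rightarrow> real" where
  "slack_gradient A k i = (case k of Inl l \<Rightarrow> of_bool (i = l) | Inr j \<Rightarrow> - A j i)"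

text \<open>Moving \<open>b\<close> in this direction relaxes the constraint with index \<open>k\<close>; for a sign constraint this is
  true up to a translation of the unknowns.\<close>
definition relaxation_direction :: "(nat \<Rightarrow> nat \<Rightarrow> real) \<Rightarrow> nat + nat \<Rightarrow> nat \<Rightarrow> real" where
  "relaxation_direction A k j = (case k of Inl i \<Rightarrow> A j i | Inr l \<Rightarrow> of_bool (j = l))"

text \<open>Indexed so as to be the complementary partner of \<open>scheme_value\<close> at the same
  index: reduced costs pair with variables, dual variables with slacks.\<close>

definition dual_value ::
  "nat \<Rightarrow> (nat \<Rightarrow> nat \<Rightarrow> real) \<Rightarrow> (nat \<Rightarrow> real) \<Rightarrow> (nat \<Rightarrow> real) \<Rightarrow> nat + nat \<Rightarrow> real" where
  "dual_value m A c y k = (case k of Inl i \<Rightarrow> (\<Sum>j<m. y j * A j i) - c i | Inr j \<Rightarrow> y j)"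

text \<open>A dual point \<open>y\<close> certifies that \<open>x\<close> is optimal up to \<open>d\<close>.\<close>
definition near_opt_split where
  "near_opt_split m n A b c k p q d \<longleftrightarrow>
     (\<exists>x y. primal_feasible m n A b x \<and> dual_feasible m n A c y \<and>
        objective m b y - objective n c x \<le> d \<and> scheme_value n A b x k \<le> p) \<and>
     (\<exists>x y. primal_feasible m n A b x \<and> dual_feasible m n A c y \<and>
        objective m b y - objective n c x \<le> d \<and> q \<le> scheme_value n A b x k)"

text \<open>Quantitative failure of strict complementarity. By weak duality the inequality between
  the objectives already forces an optimal pair; with inequalities throughout, the condition on
  \<open>(x, y)\<close> is closed, as the measurability proof requires.\<close>

definition near_degenerate where
  "near_degenerate m n A b c k \<eta> \<longleftrightarrow> (\<exists>x y.
     primal_feasible m n A b x \<and> dual_feasible m n A c y \<and>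
     objective m b y \<le> objective n c x \<and> dual_value m A c y k \<le> 0 \<and> scheme_value n A b x k \<le> \<eta>)"

definition unique_primal where
  "unique_primal m n A b c \<longleftrightarrow>
     (\<forall>x x'. primal_opt m n A b c x \<longrightarrow> primal_opt m n A b c x' \<longrightarrow> (\<forall>i<n. x i = x' i))"

text \<open>The dual rewritten as a program in primal form with transposed, negated data, so that
  every fact on primal uniqueness transfers.\<close>

abbreviation unique_dual where
  "unique_dual m n A b c \<equiv> unique_primal n m (\<lambda>i j. - A j i) (\<lambda>i. - c i) (\<lambda>j. - b j)"

definition ill_conditioned where
  "ill_conditioned m n A b c \<epsilon> \<longleftrightarrow> \<not> unique_primal m n A b c \<or> \<not> unique_dual m n A b c \<or>
     (\<exists>k\<in>scheme_index m n. near_degenerate m n A b c k (2 * sqrt \<epsilon>) \<or>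
        near_opt_split m n A b c k 0 (sqrt \<epsilon>) \<epsilon> \<or>
        near_opt_split m n A b c k (sqrt \<epsilon>) (2 * sqrt \<epsilon>) \<epsilon>)"

section \<open>Feasibility, duality gap and optimality in terms of these values\<close>

lemma finite_scheme_index [simp]: "finite (scheme_index m n)"
  by (simp add: scheme_index_def)

lemma card_scheme_index: "card (scheme_index m n) = m + n"
  unfolding scheme_index_def by (subst card_Un_disjoint) (auto simp: card_image)

lemma scheme_index_simps [simp]:
  "Inl i \<in> scheme_index m n \<longleftrightarrow> i < n" "Inr j \<in> scheme_index m n \<longleftrightarrow> j < m"
  by (auto simp: scheme_index_def)

lemma scheme_index_cases:
  assumes "k \<in> scheme_index m n"
  obtains i where "i < n" "k = Inl i" | j where "j < m" "k = Inr j"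
  using assms by (auto simp: scheme_index_def)

lemma primal_feasible_iff:
  "primal_feasible m n A b x \<longleftrightarrow> (\<forall>k\<in>scheme_index m n. 0 \<le> scheme_value n A b x k)"
  by (auto simp: primal_feasible_def scheme_index_def scheme_value_def ball_Un)

lemma dual_feasible_iff:
  "dual_feasible m n A c y \<longleftrightarrow> (\<forall>k\<in>scheme_index m n. 0 \<le> dual_value m A c y k)"
  by (auto simp: dual_feasible_def scheme_index_def dual_value_def ball_Un)

lemma scheme_value_add:
  assumes "k \<in> scheme_index m n"
  shows "scheme_value n A b (\<lambda>i. x i + t * d i) k
    = scheme_value n A b x k + t * (\<Sum>i<n. slack_gradient A k i * d i)"
  using assms
  by (cases rule: scheme_index_cases)
     (auto simp: scheme_value_def slack_gradient_def sum_negf algebra_simps sum.distrib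
        sum_distrib_left of_bool_def if_distrib[of "\<lambda>x. _ * x"] cong: if_cong)

lemma scheme_value_diff:
  assumes "k \<in> scheme_index m n"
  shows "scheme_value n A b x' k - scheme_value n A b x k
    = (\<Sum>i<n. slack_gradient A k i * x' i) - (\<Sum>i<n. slack_gradient A k i * x i)"
  using scheme_value_add[OF assms, of A b x 1 "\<lambda>i. x' i - x i"]
  by (simp add: right_diff_distrib sum_subtractf)

text \<open>The source of complementary slackness. It also shows that the gap stays the same when a
  primal value changes only where its dual partner vanishes.\<close>

lemma duality_gap_eq:
  "objective m b y - objective n c x
    = (\<Sum>k\<in>scheme_index m n. scheme_value n A b x k * dual_value m A c y k)"
proof -
  have "(\<Sum>k\<in>scheme_index m n. scheme_value n A b x k * dual_value m A c y k)
      = (\<Sum>i<n. x i * ((\<Sum>j<m. y j * A j i) - c i)) + (\<Sum>j<m. (b j - (\<Sum>i<n. A j i * x i)) * y j)"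
    unfolding scheme_index_def
    by (subst sum.union_disjoint) (auto simp: sum.reindex scheme_value_def dual_value_def)
  then show ?thesis
    using double_sum_swap[of y A m x n]
    by (simp add: objective_def algebra_simps sum_subtractf)
qed

lemma optimal_pair:
  assumes "primal_feasible m n A b x" "dual_feasible m n A c y" "objective m b y \<le> objective n c x"
  shows "primal_opt m n A b c x" "dual_opt m n A b c y"
  using assms weak_duality[of m n A b] weak_duality[of m n A b x c]
  unfolding primal_opt_def dual_opt_def by (meson order_trans)+

lemma primal_opt_imp_feasible_bounded:
  "primal_opt m n A b c x \<Longrightarrow> lp_feasible_bounded m n A b c"
  unfolding primal_opt_def lp_feasible_bounded_def by blast

lemma strong_duality_opt:
  assumes "lp_feasible_bounded m n A b c"
  shows "\<exists>x y. primal_opt m n A b c x \<and> dual_opt m n A b c y"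
  using strong_duality[OF assms] optimal_pair by fastforce

lemma opt_objective_eq:
  assumes "primal_opt m n A b c x" "dual_opt m n A b c y"
  shows "objective m b y = objective n c x"
proof -
  obtain x' y' where "primal_feasible m n A b x'" "dual_feasible m n A c y'" "objective m b y' = objective n c x'"
    using strong_duality[OF primal_opt_imp_feasible_bounded[OF assms(1)]] by blast
  with assms show ?thesis
    using weak_duality[of m n A b x c y] unfolding primal_opt_def dual_opt_def by fastforce
qed

lemma primal_feasible_transpose:
  "primal_feasible n m (\<lambda>i j. - A j i) (\<lambda>i. - c i) y \<longleftrightarrow> dual_feasible m n A c y"
  by (simp add: primal_feasible_def dual_feasible_def sum_negf mult.commute)

lemma primal_opt_transpose:
  "primal_opt n m (\<lambda>i j. - A j i) (\<lambda>i. - c i) (\<lambda>j. - b j) y \<longleftrightarrow> dual_opt m n A b c y"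
  by (simp add: primal_opt_def dual_opt_def primal_feasible_transpose objective_def sum_negf)

section \<open>Recurrence of the exceptional events along lines\<close>

text \<open>Exchange argument: take \<open>x'\<close> near-optimal for \<open>c\<close> with a high
  value at \<open>k\<close>, and \<open>z\<close> near-optimal for \<open>c'\<close> with a low one.
  Each beats the other up to \<open>d\<close> under its own objective; adding the two comparisons
  cancels \<open>c\<close> and leaves \<open>s\<close> times the difference of the values.\<close>

lemma near_opt_split_shift:
  assumes split: "near_opt_split m n A b c k p q d" "near_opt_split m n A b c' k p q d"
    and k: "k \<in> scheme_index m n"
    and c': "\<And>i. i < n \<Longrightarrow> c' i = c i + s * slack_gradient A k i" and s: "0 \<le> s"
  shows "s * (q - p) \<le> 2 * d"
proof -
  obtain x' y z w where
    x: "primal_feasible m n A b x'" "dual_feasible m n A c y" "objective m b y - objective n c x' \<le> d"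
      "q \<le> scheme_value n A b x' k"
    and z: "primal_feasible m n A b z" "dual_feasible m n A c' w" "objective m b w - objective n c' z \<le> d"
      "scheme_value n A b z k \<le> p"
    using split unfolding near_opt_split_def by blast
  have obj: "objective n c' u = objective n c u + s * (\<Sum>i<n. slack_gradient A k i * u i)" for u
    using c' by (simp add: objective_def algebra_simps sum.distrib sum_distrib_left)
  have "objective n c z \<le> objective m b y" "objective n c' x' \<le> objective m b w"
    using weak_duality x z by blast+
  with x(3) z(3) have "s * (\<Sum>i<n. slack_gradient A k i * x' i) - s * (\<Sum>i<n. slack_gradient A k i * z i) \<le> 2 * d"
    by (simp add: obj)
  then have "s * (scheme_value n A b x' k - scheme_value n A b z k) \<le> 2 * d"
    by (simp add: scheme_value_diff[OF k] right_diff_distrib)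
  moreover have "s * (q - p) \<le> s * (scheme_value n A b x' k - scheme_value n A b z k)"
    using x(4) z(4) s by (intro mult_left_mono) auto
  ultimately show ?thesis by linarith
qed

text \<open>Relaxing constraint \<open>k\<close> changes only a slack whose dual partner is zero, so
  the old optimum, suitably translated, stays optimal for \<open>b'\<close> with value at least
  \<open>s\<close> at \<open>k\<close>. By uniqueness it agrees with the optimum witnessing
  degeneracy for \<open>b'\<close>, whose value is at most \<open>\<eta>\<close>.\<close>

lemma near_degenerate_shift:
  assumes deg: "near_degenerate m n A b c k \<eta>" "near_degenerate m n A b' c k \<eta>"
    and uniq: "unique_primal m n A b' c" and k: "k \<in> scheme_index m n"
    and b': "\<And>j. j < m \<Longrightarrow> b' j = b j + s * relaxation_direction A k j" and s: "0 \<le> s"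
  shows "s \<le> \<eta>"
proof -
  obtain x y where xy: "primal_feasible m n A b x" "dual_feasible m n A c y"
      "objective m b y \<le> objective n c x" "dual_value m A c y k \<le> 0"
    using deg(1) unfolding near_degenerate_def by blast
  obtain z w where z: "primal_feasible m n A b' z" "dual_feasible m n A c w"
      "objective m b' w \<le> objective n c z" "scheme_value n A b' z k \<le> \<eta>"
    using deg(2) unfolding near_degenerate_def by blast
  have y0: "dual_value m A c y k = 0" using xy(2,4) k by (simp add: dual_feasible_iff antisym)
  \<comment> \<open>For a sign constraint \<open>b\<close> moves along a column of \<open>A\<close>.
    Raising that variable by \<open>s\<close> absorbs the change in all rows, so only the variable
    itself gains \<open>s\<close>.\<close>
  define x' where "x' = (\<lambda>i. x i + s * (case k of Inl l \<Rightarrow> of_bool (i = l) | Inr _ \<Rightarrow> 0))"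
  have shifted: "scheme_value n A b' x' h = scheme_value n A b x h + s * of_bool (h = k)"
    if "h \<in> scheme_index m n" for h
  proof (cases k)
    case (Inl l)
    have sums: "(\<Sum>i<n. A j i * x' i) = (\<Sum>i<n. A j i * x i) + s * A j l" for j
      using k Inl by (simp add: x'_def of_bool_def distrib_left sum.distrib if_distrib[of "\<lambda>x. _ * x"] cong: if_cong)
    show ?thesis using that Inl sums
      by (cases rule: scheme_index_cases) (auto simp: scheme_value_def b' relaxation_direction_def x'_def)
  next
    case (Inr l)
    then have "x' = x" by (simp add: x'_def)
    show ?thesis using that Inr \<open>x' = x\<close>
      by (cases rule: scheme_index_cases) (auto simp: scheme_value_def b' relaxation_direction_def)
  qed
  then have feas: "primal_feasible m n A b' x'"
    using xy(1) s by (auto simp: primal_feasible_iff)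
  have "objective m b' y - objective n c x'
      = (\<Sum>h\<in>scheme_index m n. scheme_value n A b x h * dual_value m A c y h)"
    unfolding duality_gap_eq[of m b' y n c x' A] using y0
    by (intro sum.cong) (auto simp: shifted)
  then have "objective m b' y \<le> objective n c x'"
    using xy(3) by (simp add: duality_gap_eq[symmetric])
  then have "primal_opt m n A b' c x'" "primal_opt m n A b' c z"
    using optimal_pair feas xy(2) z by blast+
  then have eq: "x' i = z i" if "i < n" for i
    using uniq that unfolding unique_primal_def by blast
  have "scheme_value n A b' x' k = scheme_value n A b' z k"
    using k eq by (cases rule: scheme_index_cases) (auto simp: scheme_value_def)
  moreover have "0 \<le> scheme_value n A b x k"
    using xy(1) k by (simp add: primal_feasible_iff)
  ultimately show ?thesis using z(4) shifted[OF k] by simp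
qed

lemma not_unique_primal_imp_split:
  assumes "\<not> unique_primal m n A b c"
  shows "\<exists>i<n. \<exists>p\<in>\<rat>. \<exists>q\<in>\<rat>. p < q \<and> near_opt_split m n A b c (Inl i) p q 0"
proof -
  obtain x x' i where x: "primal_opt m n A b c x" "primal_opt m n A b c x'" "i < n" "x i \<noteq> x' i"
    using assms unfolding unique_primal_def by blast
  obtain y where y: "dual_opt m n A b c y"
    using strong_duality_opt primal_opt_imp_feasible_bounded[OF x(1)] by blast
  have *: "\<exists>p\<in>\<rat>. \<exists>q\<in>\<rat>. p < q \<and> near_opt_split m n A b c (Inl i) p q 0"
    if uv: "primal_opt m n A b c u" "primal_opt m n A b c v" "u i < v i" for u v
  proof -
    obtain p where p: "p \<in> \<rat>" "u i < p" "p < v i" using Rats_dense_in_real uv(3) by blast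
    obtain q where q: "q \<in> \<rat>" "p < q" "q < v i" using Rats_dense_in_real p(3) by blast
    have "near_opt_split m n A b c (Inl i) p q 0"
      unfolding near_opt_split_def
      using uv y p(2) q(3) opt_objective_eq[OF uv(1) y] opt_objective_eq[OF uv(2) y]
      by (intro conjI[OF exI[of _ u, OF exI[of _ y]] exI[of _ v, OF exI[of _ y]]])
         (auto simp: primal_opt_def dual_opt_def scheme_value_def)
    with p q show ?thesis by blast
  qed
  from x(4) have "x i < x' i \<or> x' i < x i" by linarith
  with * x show ?thesis by blast
qed

text \<open>Two optima differ in some coordinate, and rationals fit between its two values.
  Non-uniqueness thus becomes a countable union of splits with gap 0, which serves both its
  measurability and its null probability.\<close>

lemma not_unique_primal_iff:
  "\<not> unique_primal m n A b c
    \<longleftrightarrow> (\<exists>i<n. \<exists>p\<in>\<rat>. \<exists>q\<in>\<rat>. p < q \<and> near_opt_split m n A b c (Inl i) p q 0)" (is "_ \<longleftrightarrow> ?R")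
proof
  assume ?R
  then obtain i p q x x' y y' where *: "i < n" "p < q"
    "primal_feasible m n A b x" "dual_feasible m n A c y" "objective m b y \<le> objective n c x" "x i \<le> p"
    "primal_feasible m n A b x'" "dual_feasible m n A c y'" "objective m b y' \<le> objective n c x'" "q \<le> x' i"
    unfolding near_opt_split_def scheme_value_def by auto
  then have "primal_opt m n A b c x" "primal_opt m n A b c x'" using optimal_pair(1) by blast+
  moreover have "x i \<noteq> x' i" using * by linarith
  ultimately show "\<not> unique_primal m n A b c" using \<open>i < n\<close> unfolding unique_primal_def by blast
qed (rule not_unique_primal_imp_split)

section \<open>Tight constraints at unique optima\<close>

lemma finite_small_step:
  fixes f g :: "'k \<Rightarrow> real"
  assumes "finite K" "\<And>k. k \<in> K \<Longrightarrow> 0 < f k"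
  shows "\<exists>t>0. \<forall>k\<in>K. \<bar>t * g k\<bar> \<le> f k"
  using assms
proof (induction K rule: finite_induct)
  case empty
  show ?case by (auto intro: exI[of _ 1])
next
  case (insert k K)
  then obtain t where t: "0 < t" "\<And>h. h \<in> K \<Longrightarrow> \<bar>t * g h\<bar> \<le> f h" by auto
  define u where "u = min t (f k / (1 + \<bar>g k\<bar>))"
  have pos: "0 < f k" using insert.prems by simp
  then have "0 < u" using t(1) by (simp add: u_def)
  moreover have "\<bar>u * g h\<bar> \<le> f h" if "h \<in> K" for h
  proof -
    have "\<bar>u * g h\<bar> \<le> \<bar>t * g h\<bar>"
      using \<open>0 < u\<close> by (auto simp: abs_mult u_def intro!: mult_right_mono)
    with t(2)[OF that] show ?thesis by linarith
  qed
  moreover have "\<bar>u * g k\<bar> \<le> f k"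
  proof -
    have "\<bar>u * g k\<bar> \<le> u * (1 + \<bar>g k\<bar>)" using \<open>0 < u\<close> by (simp add: abs_mult)
    also have "\<dots> \<le> f k / (1 + \<bar>g k\<bar>) * (1 + \<bar>g k\<bar>)"
      by (intro mult_right_mono) (auto simp: u_def)
    finally show ?thesis by simp
  qed
  ultimately show ?case by auto
qed

text \<open>With fewer than \<open>n\<close> tight constraints there is a nonzero direction that
  keeps all of them tight, and a small step along it in either sense stays feasible.\<close>

lemma unique_primal_tight_constraints:
  assumes uniq: "unique_primal m n A b c" and x: "primal_opt m n A b c x"
  shows "n \<le> card {k\<in>scheme_index m n. scheme_value n A b x k = 0}"
proof (rule ccontr)
  define B where "B = {k\<in>scheme_index m n. scheme_value n A b x k = 0}"
  assume "\<not> ?thesis"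
  then have "card B < card {..<n}" by (simp add: B_def)
  then obtain d where d: "\<exists>i<n. d i \<noteq> 0" "\<And>k. k \<in> B \<Longrightarrow> (\<Sum>i<n. slack_gradient A k i * d i) = 0"
    using homogeneous_system_nontrivial[of B "{..<n}" "slack_gradient A"] by (auto simp: B_def)
  let ?g = "\<lambda>k. \<Sum>i<n. slack_gradient A k i * d i"
  have nonneg: "0 \<le> scheme_value n A b x k" if "k \<in> scheme_index m n" for k
    using x that by (simp add: primal_opt_def primal_feasible_iff)
  have "0 < scheme_value n A b x k" if "k \<in> scheme_index m n - B" for k
    using nonneg[of k] that by (force simp: B_def)
  then obtain t where t: "0 < t" "\<And>k. k \<in> scheme_index m n - B \<Longrightarrow> \<bar>t * ?g k\<bar> \<le> scheme_value n A b x k"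
    using finite_small_step[of "scheme_index m n - B" "scheme_value n A b x" ?g] by auto
  \<comment> \<open>The sign prevents the objective from decreasing, so the moved point is a second
    optimum.\<close>
  define s where "s = (if 0 \<le> objective n c d then t else - t)"
  have "\<bar>s * ?g k\<bar> \<le> scheme_value n A b x k" if "k \<in> scheme_index m n" for k
    using t(2)[of k] d(2)[of k] nonneg[OF that] that by (cases "k \<in> B") (auto simp: s_def)
  then have feas: "primal_feasible m n A b (\<lambda>i. x i + s * d i)"
    unfolding primal_feasible_iff by (auto simp: scheme_value_add abs_le_iff) (smt (verit))
  have "0 \<le> s * objective n c d"
    using t(1) by (auto simp: s_def zero_le_mult_iff)
  then have "objective n c x \<le> objective n c (\<lambda>i. x i + s * d i)"
    by (simp add: objective_def distrib_left sum.distrib sum_distrib_left mult.left_commute)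
  with feas x have "primal_opt m n A b c (\<lambda>i. x i + s * d i)"
    unfolding primal_opt_def by (meson order_trans)
  with x uniq have "x i = x i + s * d i" if "i < n" for i
    using that unfolding unique_primal_def by blast
  moreover have "s \<noteq> 0" using t(1) by (simp add: s_def)
  ultimately show False using d(1) by auto
qed

lemma scheme_value_transpose:
  "scheme_value m (\<lambda>i j. - A j i) (\<lambda>i. - c i) y (case_sum Inr Inl k) = dual_value m A c y k"
  by (cases k) (simp_all add: scheme_value_def dual_value_def sum_negf mult.commute)

text \<open>The primal statement for the transposed program. \<open>?flip\<close> exchanges
  variables and rows, under which primal values of the transposed program are dual values of the
  original.\<close>

lemma unique_dual_tight_constraints:
  assumes "unique_dual m n A b c" "dual_opt m n A b c y"
  shows "m \<le> card {k\<in>scheme_index m n. dual_value m A c y k = 0}"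
proof -
  let ?flip = "case_sum Inr Inl :: nat + nat \<Rightarrow> nat + nat"
  let ?T = "{k\<in>scheme_index n m. scheme_value m (\<lambda>i j. - A j i) (\<lambda>i. - c i) y k = 0}"
  have flip: "?flip (?flip k) = k" for k by (cases k) auto
  have "?T = ?flip ` {k\<in>scheme_index m n. dual_value m A c y k = 0}"
  proof (intro equalityI subsetI)
    fix k assume k: "k \<in> ?T"
    then have "?flip k \<in> {k\<in>scheme_index m n. dual_value m A c y k = 0}"
      by (cases k) (auto simp: scheme_value_transpose[symmetric])
    then show "k \<in> ?flip ` {k\<in>scheme_index m n. dual_value m A c y k = 0}"
      using flip[of k] by (metis imageI)
  next
    fix k assume "k \<in> ?flip ` {k\<in>scheme_index m n. dual_value m A c y k = 0}"
    then obtain h where h: "h \<in> scheme_index m n" "dual_value m A c y h = 0" "k = ?flip h" by blast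
    moreover from h have "?flip h \<in> scheme_index n m"
      by (cases h) auto
    ultimately show "k \<in> ?T" by (simp add: scheme_value_transpose)
  qed
  moreover have "m \<le> card ?T"
    using assms by (intro unique_primal_tight_constraints) (auto simp: primal_opt_transpose)
  moreover have "card (?flip ` {k\<in>scheme_index m n. dual_value m A c y k = 0})
      \<le> card {k\<in>scheme_index m n. dual_value m A c y k = 0}"
    by (intro card_image_le) auto
  ultimately show ?thesis by simp
qed

section \<open>From separated values to the correct guess\<close>

text \<open>Sets of equal size that differ each contain an element missing from the other; strict
  separation of the values then contradicts minimality of \<open>S\<close>. In particular ties
  cannot affect the choice.\<close>

lemma smallest_n_eq:
  assumes S: "smallest_n m n A b x S" and B: "B \<subseteq> scheme_index m n" "card B = n"
    and sep: "\<And>s t. s \<in> B \<Longrightarrow> t \<in> scheme_index m n - B \<Longrightarrow> scheme_value n A b x s < scheme_value n A b x t"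
  shows "S = B"
proof (rule ccontr)
  have fin: "finite S" "finite B"
    using S B finite_subset[OF _ finite_scheme_index] by (auto simp: smallest_n_def)
  assume "S \<noteq> B"
  then have "\<not> S \<subseteq> B" "\<not> B \<subseteq> S"
    using S B fin card_subset_eq[of B S] card_subset_eq[of S B] by (auto simp: smallest_n_def)
  then obtain s t where "s \<in> S" "s \<notin> B" "t \<in> B" "t \<notin> S" by blast
  with S B sep[of t s] show False by (force simp: smallest_n_def)
qed

text \<open>By complementary slackness one value of each pair vanishes, and by non-degeneracy only
  one. The two counts of vanishing values therefore add up to \<open>m + n\<close>, and the lower
  bounds \<open>n\<close> and \<open>m\<close> from uniqueness must be attained.\<close>

lemma well_conditioned_basis:
  assumes eps: "0 < \<epsilon>" and good: "\<not> ill_conditioned m n A b c \<epsilon>"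
    and x: "primal_opt m n A b c x" and y: "dual_opt m n A b c y"
  shows "card {k\<in>scheme_index m n. scheme_value n A b x k = 0} = n"
    and "k \<in> scheme_index m n \<Longrightarrow> scheme_value n A b x k = 0 \<longleftrightarrow> 0 < dual_value m A c y k"
    and "k \<in> scheme_index m n \<Longrightarrow> scheme_value n A b x k \<noteq> 0 \<Longrightarrow> 2 * sqrt \<epsilon> < scheme_value n A b x k"
proof -
  let ?I = "scheme_index m n" and ?s = "scheme_value n A b x" and ?t = "dual_value m A c y"
  have obj: "objective m b y = objective n c x" by (rule opt_objective_eq[OF x y])
  have nonneg: "0 \<le> ?s k" "0 \<le> ?t k" if "k \<in> ?I" for k
    using x y that by (auto simp: primal_opt_def dual_opt_def primal_feasible_iff dual_feasible_iff)
  have large: "2 * sqrt \<epsilon> < ?s k" if "k \<in> ?I" "?t k = 0" for k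
  proof -
    have "\<not> near_degenerate m n A b c k (2 * sqrt \<epsilon>)"
      using good that by (auto simp: ill_conditioned_def)
    then show ?thesis
      using x y obj that unfolding near_degenerate_def primal_opt_def dual_opt_def by force
  qed
  have "(\<Sum>k\<in>?I. ?s k * ?t k) = 0"
    using obj by (simp add: duality_gap_eq[symmetric])
  then have "?s k * ?t k = 0" if "k \<in> ?I" for k
    using that nonneg by (simp add: sum_nonneg_eq_0_iff)
  then have iff: "?s k = 0 \<longleftrightarrow> 0 < ?t k" if "k \<in> ?I" for k
    using that nonneg(2)[OF that] large[OF that] eps
    by (smt (verit) mult_eq_0_iff real_sqrt_gt_zero)
  then show "k \<in> ?I \<Longrightarrow> ?s k = 0 \<longleftrightarrow> 0 < ?t k" .
  show "k \<in> ?I \<Longrightarrow> ?s k \<noteq> 0 \<Longrightarrow> 2 * sqrt \<epsilon> < ?s k"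
    using iff[of k] large[of k] nonneg(2)[of k] by force
  have uniq: "unique_primal m n A b c" "unique_dual m n A b c"
    using good by (auto simp: ill_conditioned_def)
  have "n \<le> card {k\<in>?I. ?s k = 0}" by (rule unique_primal_tight_constraints[OF uniq(1) x])
  moreover have "m \<le> card {k\<in>?I. ?t k = 0}" by (rule unique_dual_tight_constraints[OF uniq(2) y])
  moreover have "card {k\<in>?I. ?s k = 0} + card {k\<in>?I. ?t k = 0} = m + n"
  proof -
    have "card {k\<in>?I. ?s k = 0} + card {k\<in>?I. ?t k = 0} = card ({k\<in>?I. ?s k = 0} \<union> {k\<in>?I. ?t k = 0})"
      using iff by (intro card_Un_disjoint[symmetric]) fastforce+
    also have "{k\<in>?I. ?s k = 0} \<union> {k\<in>?I. ?t k = 0} = ?I"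
      using iff nonneg(2) by force
    finally show ?thesis by (simp add: card_scheme_index)
  qed
  ultimately show "card {k\<in>?I. ?s k = 0} = n" by linarith
qed

text \<open>\<open>ys\<close> certifies both \<open>xs\<close> and \<open>x\<close> as
  \<open>\<epsilon>\<close>-optimal. A value that is 0 at \<open>xs\<close> cannot reach
  \<open>sqrt \<epsilon>\<close> at \<open>x\<close>, and one above
  \<open>2 * sqrt \<epsilon>\<close> at \<open>xs\<close> cannot drop to
  \<open>sqrt \<epsilon>\<close>, since either would be an excluded split.\<close>

lemma well_conditioned_guess_correct:
  assumes eps: "0 < \<epsilon>" and good: "\<not> ill_conditioned m n A b c \<epsilon>"
    and xs: "primal_opt m n A b c xs" and ys: "dual_opt m n A b c ys"
    and x: "primal_feasible m n A b x" "objective n c xs - objective n c x < \<epsilon>"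
  shows "guess_correct m n A b x {i. i < n \<and> 0 < xs i} {j. j < m \<and> 0 < ys j}"
proof -
  define B where "B = {k\<in>scheme_index m n. scheme_value n A b xs k = 0}"
  have obj: "objective m b ys = objective n c xs" by (rule opt_objective_eq[OF xs ys])
  note basis = well_conditioned_basis[OF eps good xs ys]
  have near: "objective m b ys - objective n c x \<le> \<epsilon>" "objective m b ys - objective n c xs \<le> \<epsilon>"
    using x(2) obj eps by auto
  have feas: "primal_feasible m n A b xs" "dual_feasible m n A c ys"
    using xs ys by (auto simp: primal_opt_def dual_opt_def)
  have small: "scheme_value n A b x s < sqrt \<epsilon>" if "s \<in> B" for s
  proof -
    have "\<not> near_opt_split m n A b c s 0 (sqrt \<epsilon>) \<epsilon>"
      using good that by (auto simp: ill_conditioned_def B_def)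
    moreover have "scheme_value n A b xs s \<le> 0" using that by (simp add: B_def)
    ultimately show ?thesis using x(1) feas near unfolding near_opt_split_def by force
  qed
  have large: "sqrt \<epsilon> < scheme_value n A b x t" if "t \<in> scheme_index m n - B" for t
  proof -
    have "\<not> near_opt_split m n A b c t (sqrt \<epsilon>) (2 * sqrt \<epsilon>) \<epsilon>"
      using good that by (auto simp: ill_conditioned_def)
    moreover have "2 * sqrt \<epsilon> \<le> scheme_value n A b xs t"
      using basis(3)[of t] that by (auto simp: B_def)
    ultimately show ?thesis using x(1) feas near unfolding near_opt_split_def by force
  qed
  have "{i. i < n \<and> Inl i \<notin> S} = {i. i < n \<and> 0 < xs i} \<and> {j. j < m \<and> Inr j \<in> S} = {j. j < m \<and> 0 < ys j}"
    if "smallest_n m n A b x S" for S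
  proof -
    have "S = B"
      using that basis(1) small large
      by (intro smallest_n_eq[OF that]) (auto simp: B_def intro: less_trans)
    moreover have "0 \<le> xs i" if "i < n" for i using feas(1) that by (simp add: primal_feasible_def)
    ultimately show ?thesis
      using basis(2)[of "Inr _"]
      by (auto simp: B_def scheme_value_def dual_value_def less_le)
  qed
  then show ?thesis unfolding guess_correct_def by blast
qed

lemma well_conditioned_delta:
  assumes eps: "0 < \<epsilon>" and good: "\<not> ill_conditioned m n A b c \<epsilon>"
  shows "ereal \<epsilon> \<le> lp_delta m n A b c"
proof (cases "lp_feasible_bounded m n A b c")
  case False
  then show ?thesis by (simp add: lp_delta_def)
next
  case True
  have "lp_unique_opt m n A b c"
    using strong_duality_opt[OF True] good
    unfolding lp_unique_opt_def ill_conditioned_def unique_primal_def primal_opt_transpose by blast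
  then show ?thesis
    using True well_conditioned_guess_correct[OF eps good]
    by (auto simp: lp_delta_def intro!: Sup_upper)
qed

lemma lp_cost_le:
  assumes "0 < \<epsilon>" "\<not> ill_conditioned m n A b c \<epsilon>"
  shows "lp_cost m n A b c \<le> ennreal (max 1 (ln (1 / \<epsilon>)))"
proof -
  have le: "ereal \<epsilon> \<le> lp_delta m n A b c" by (rule well_conditioned_delta[OF assms])
  show ?thesis
  proof (cases "lp_delta m n A b c")
    case (real r)
    with le assms(1) have "\<epsilon> \<le> r" "0 < r" by auto
    with assms(1) have "ln (1 / r) \<le> ln (1 / \<epsilon>)" by (simp add: ln_div)
    then have "max 1 (ln (1 / r)) \<le> max 1 (ln (1 / \<epsilon>))" by (rule max.mono[OF order_refl])
    with real \<open>0 < r\<close> show ?thesis by (simp add: lp_cost_def ennreal_leI)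
  next
    case PInf
    have "ennreal 1 \<le> ennreal (max 1 (ln (1 / \<epsilon>)))" by (intro ennreal_leI) simp
    with PInf show ?thesis by (simp add: lp_cost_def)
  next
    case MInf
    with le show ?thesis by simp
  qed
qed

section \<open>Anticoncentration of Gaussian vectors along a line\<close>

lemma sets_gauss [simp, measurable_cong]: "sets (gauss \<mu> \<sigma>) = sets borel"
  by (simp add: gauss_def)

lemma space_gauss [simp]: "space (gauss \<mu> \<sigma>) = UNIV"
  by (simp add: gauss_def)

lemma prob_space_gauss: "0 < \<sigma> \<Longrightarrow> prob_space (gauss \<mu> \<sigma>)"
  unfolding gauss_def by (rule prob_space_normal_density)

lemma gauss_shift:
  assumes "0 < \<sigma>"
  shows "distr (gauss \<mu> \<sigma>) borel (\<lambda>x. x + a) = gauss (\<mu> + a) \<sigma>"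
proof -
  interpret prob_space "gauss \<mu> \<sigma>" by (rule prob_space_gauss[OF assms])
  have "distributed (gauss \<mu> \<sigma>) lborel (\<lambda>x. x) (normal_density \<mu> \<sigma>)"
    unfolding distributed_def
    by (auto simp: gauss_def intro!: measure_eqI simp: emeasure_distr)
  from normal_density_affine[OF this assms, of 1 a]
  have "distr (gauss \<mu> \<sigma>) lborel (\<lambda>x. a + x) = gauss (\<mu> + a) \<sigma>"
    by (simp add: distributed_def gauss_def add.commute)
  moreover have "distr (gauss \<mu> \<sigma>) lborel (\<lambda>x. a + x) = distr (gauss \<mu> \<sigma>) borel (\<lambda>x. x + a)"
    by (rule distr_cong) (auto simp: add.commute)
  ultimately show ?thesis by simp
qed

text \<open>Likelihood ratio of the translated law, by completing the square. The exponent is linear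
  in \<open>x\<close>, so opposite translations have opposite linear terms.\<close>

lemma normal_density_shift:
  assumes "0 < \<sigma>"
  shows "normal_density (\<mu> + a) \<sigma> x
    = normal_density \<mu> \<sigma> x * exp (a * (x - \<mu>) / \<sigma>\<^sup>2 - a\<^sup>2 / (2 * \<sigma>\<^sup>2))"
proof -
  have "- (x - (\<mu> + a))\<^sup>2 / (2 * \<sigma>\<^sup>2)
      = - (x - \<mu>)\<^sup>2 / (2 * \<sigma>\<^sup>2) + (a * (x - \<mu>) / \<sigma>\<^sup>2 - a\<^sup>2 / (2 * \<sigma>\<^sup>2))"
    using assms by (simp add: field_simps power2_eq_square)
  then show ?thesis by (simp add: normal_density_def mult_exp_exp del: minus_divide_left)
qed

lemma gauss_density_shift:
  assumes "0 < \<sigma>"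
  shows "gauss (\<mu> + a) \<sigma>
    = density (gauss \<mu> \<sigma>) (\<lambda>x. ennreal (exp (a * (x - \<mu>) / \<sigma>\<^sup>2 - a\<^sup>2 / (2 * \<sigma>\<^sup>2))))"
  unfolding gauss_def
  by (subst density_density_eq)
     (auto simp: normal_density_shift[OF assms] ennreal_mult normal_density_nonneg)

text \<open>It suffices to compare on rectangles, where the integral of the product density factors
  over the coordinates.\<close>

lemma PiM_density:
  assumes "finite I" "product_sigma_finite M" "product_sigma_finite (\<lambda>i. density (M i) (f i))"
    and [measurable]: "\<And>i. f i \<in> borel_measurable (M i)"
  shows "PiM I (\<lambda>i. density (M i) (f i)) = density (PiM I M) (\<lambda>x. \<Prod>i\<in>I. f i (x i))"
proof -
  interpret M: product_sigma_finite M by fact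
  interpret D: product_sigma_finite "\<lambda>i. density (M i) (f i)" by fact
  show ?thesis
  proof (rule D.PiM_eqI[symmetric])
    show "finite I" by fact
    show "sets (density (PiM I M) (\<lambda>x. \<Prod>i\<in>I. f i (x i))) = sets (PiM I (\<lambda>i. density (M i) (f i)))"
      by (simp cong: sets_PiM_cong)
    fix A assume "\<And>i. i \<in> I \<Longrightarrow> A i \<in> sets (density (M i) (f i))"
    then have A[measurable]: "\<And>i. i \<in> I \<Longrightarrow> A i \<in> sets (M i)" by simp
    have ind: "indicator (Pi\<^sub>E I A) x = (\<Prod>i\<in>I. indicator (A i) (x i) :: ennreal)" if "x \<in> space (PiM I M)" for x
      using that \<open>finite I\<close> by (auto simp: indicator_def prod_zero_iff space_PiM PiE_iff prod.neutral)
    have "emeasure (density (PiM I M) (\<lambda>x. \<Prod>i\<in>I. f i (x i))) (Pi\<^sub>E I A)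
        = (\<integral>\<^sup>+ x. (\<Prod>i\<in>I. f i (x i)) * indicator (Pi\<^sub>E I A) x \<partial>PiM I M)"
      using \<open>finite I\<close> A by (intro emeasure_density sets_PiM_I_finite) auto
    also have "\<dots> = (\<integral>\<^sup>+ x. (\<Prod>i\<in>I. f i (x i) * indicator (A i) (x i)) \<partial>PiM I M)"
      by (intro nn_integral_cong) (simp add: ind prod.distrib)
    also have "\<dots> = (\<Prod>i\<in>I. \<integral>\<^sup>+ x. f i x * indicator (A i) x \<partial>M i)"
      using \<open>finite I\<close> by (intro M.product_nn_integral_prod) auto
    also have "\<dots> = (\<Prod>i\<in>I. emeasure (density (M i) (f i)) (A i))"
      by (intro prod.cong) (auto simp: emeasure_density)
    finally show "emeasure (density (PiM I M) (\<lambda>x. \<Prod>i\<in>I. f i (x i))) (Pi\<^sub>E I A)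
        = (\<Prod>i\<in>I. emeasure (density (M i) (f i)) (A i))" .
  qed
qed

abbreviation gauss_vector :: "'i set \<Rightarrow> ('i \<Rightarrow> real) \<Rightarrow> real \<Rightarrow> ('i \<Rightarrow> real) measure" where
  "gauss_vector I \<mu> \<sigma> \<equiv> PiM I (\<lambda>i. gauss (\<mu> i) \<sigma>)"

lemma product_sigma_finite_gauss: "0 < \<sigma> \<Longrightarrow> product_sigma_finite (\<lambda>i. gauss (\<mu> i) \<sigma>)"
  by (simp add: product_sigma_finite_def prob_space_gauss prob_space_imp_sigma_finite)

lemma prob_space_gauss_vector: "0 < \<sigma> \<Longrightarrow> prob_space (gauss_vector I \<mu> \<sigma>)"
  by (intro prob_space_PiM prob_space_gauss)

lemma sets_gauss_vector: "sets (gauss_vector I \<mu> \<sigma>) = sets (PiM I (\<lambda>_. borel))"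
  by (intro sets_PiM_cong) auto

lemma space_gauss_vector: "space (gauss_vector I \<mu> \<sigma>) = extensional I"
  by (simp add: space_PiM PiE_UNIV_domain) (auto simp: PiE_def)

lemma measurable_translate:
  "(\<lambda>w. \<lambda>i\<in>I. w i + a i) \<in> gauss_vector I \<mu> \<sigma> \<rightarrow>\<^sub>M gauss_vector I \<nu> \<tau>"
  by (intro measurable_restrict) simp

lemma gauss_vector_shift:
  assumes "finite I" "0 < \<sigma>"
  shows "distr (gauss_vector I \<mu> \<sigma>) (gauss_vector I \<mu> \<sigma>) (\<lambda>w. \<lambda>i\<in>I. w i + a i)
    = gauss_vector I (\<lambda>i. \<mu> i + a i) \<sigma>" (is "?D = _")
proof -
  interpret M: product_sigma_finite "\<lambda>i. gauss (\<mu> i) \<sigma>" by (rule product_sigma_finite_gauss[OF assms(2)])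
  interpret S: product_sigma_finite "\<lambda>i. gauss (\<mu> i + a i) \<sigma>" by (rule product_sigma_finite_gauss[OF assms(2)])
  show ?thesis
  proof (rule S.PiM_eqI)
    show "finite I" by fact
    show "sets ?D = sets (gauss_vector I (\<lambda>i. \<mu> i + a i) \<sigma>)"
      by (simp add: sets_gauss_vector)
    fix A assume "\<And>i. i \<in> I \<Longrightarrow> A i \<in> sets (gauss (\<mu> i + a i) \<sigma>)"
    then have A[measurable]: "\<And>i. i \<in> I \<Longrightarrow> A i \<in> sets borel" by simp
    have "emeasure ?D (Pi\<^sub>E I A)
        = emeasure (gauss_vector I \<mu> \<sigma>) ((\<lambda>w. \<lambda>i\<in>I. w i + a i) -` Pi\<^sub>E I A \<inter> space (gauss_vector I \<mu> \<sigma>))"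
      using assms by (intro emeasure_distr measurable_translate sets_PiM_I_finite) auto
    also have "(\<lambda>w. \<lambda>i\<in>I. w i + a i) -` Pi\<^sub>E I A \<inter> space (gauss_vector I \<mu> \<sigma>) = Pi\<^sub>E I (\<lambda>i. (\<lambda>x. x + a i) -` A i)"
      by (auto simp: space_gauss_vector PiE_iff extensional_def)
    also have "emeasure (gauss_vector I \<mu> \<sigma>) \<dots> = (\<Prod>i\<in>I. emeasure (gauss (\<mu> i) \<sigma>) ((\<lambda>x. x + a i) -` A i))"
      using assms(1) by (intro M.emeasure_PiM) (auto intro!: measurable_sets_borel[OF _ A])
    also have "\<dots> = (\<Prod>i\<in>I. emeasure (gauss (\<mu> i + a i) \<sigma>) (A i))"
      by (intro prod.cong) (auto simp: gauss_shift[OF assms(2), symmetric] emeasure_distr)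
    finally show "emeasure ?D (Pi\<^sub>E I A) = (\<Prod>i\<in>I. emeasure (gauss (\<mu> i + a i) \<sigma>) (A i))" .
  qed
qed

lemma gauss_vector_density_shift:
  assumes "finite I" "0 < \<sigma>"
  shows "gauss_vector I (\<lambda>i. \<mu> i + a i) \<sigma> = density (gauss_vector I \<mu> \<sigma>)
    (\<lambda>w. ennreal (exp ((\<Sum>i\<in>I. a i * (w i - \<mu> i)) / \<sigma>\<^sup>2 - (\<Sum>i\<in>I. (a i)\<^sup>2) / (2 * \<sigma>\<^sup>2))))"
proof -
  let ?f = "\<lambda>i x. ennreal (exp (a i * (x - \<mu> i) / \<sigma>\<^sup>2 - (a i)\<^sup>2 / (2 * \<sigma>\<^sup>2)))"
  have eq: "(\<lambda>i. gauss (\<mu> i + a i) \<sigma>) = (\<lambda>i. density (gauss (\<mu> i) \<sigma>) (?f i))"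
    using gauss_density_shift[OF assms(2)] by simp
  have "gauss_vector I (\<lambda>i. \<mu> i + a i) \<sigma> = density (gauss_vector I \<mu> \<sigma>) (\<lambda>w. \<Prod>i\<in>I. ?f i (w i))"
    unfolding eq
  proof (rule PiM_density)
    show "product_sigma_finite (\<lambda>i. density (gauss (\<mu> i) \<sigma>) (?f i))"
      using product_sigma_finite_gauss[OF assms(2), of "\<lambda>i. \<mu> i + a i"] unfolding eq .
  qed (use assms product_sigma_finite_gauss in auto)
  moreover have "(\<Prod>i\<in>I. ?f i (w i))
      = ennreal (exp ((\<Sum>i\<in>I. a i * (w i - \<mu> i)) / \<sigma>\<^sup>2 - (\<Sum>i\<in>I. (a i)\<^sup>2) / (2 * \<sigma>\<^sup>2)))" for w
    using assms(1) by (simp add: prod_ennreal exp_sum[symmetric] sum_subtractf sum_divide_distrib)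
  ultimately show ?thesis by simp
qed

section \<open>Sets that do not recur along a line\<close>

text \<open>The likelihood ratio of a single shift has no positive lower bound in general. For
  opposite shifts the linear terms \<open>S w\<close> and \<open>- S w\<close> are combined by
  \<open>exp s + exp (- s) \<ge> 2\<close>, which leaves a factor that depends on the length of the
  shift only.\<close>

lemma gauss_vector_symmetric_shift:
  assumes "finite I" "0 < \<sigma>" and E: "E \<in> sets (gauss_vector I \<mu> \<sigma>)"
  shows "ennreal (2 * exp (- (\<Sum>i\<in>I. (a i)\<^sup>2) / (2 * \<sigma>\<^sup>2))) * emeasure (gauss_vector I \<mu> \<sigma>) E
    \<le> emeasure (gauss_vector I (\<lambda>i. \<mu> i + a i) \<sigma>) E + emeasure (gauss_vector I (\<lambda>i. \<mu> i - a i) \<sigma>) E"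
proof -
  let ?M = "gauss_vector I \<mu> \<sigma>" and ?N = "(\<Sum>i\<in>I. (a i)\<^sup>2) / (2 * \<sigma>\<^sup>2)"
  define S where "S = (\<lambda>w. (\<Sum>i\<in>I. a i * (w i - \<mu> i)) / \<sigma>\<^sup>2)"
  have [measurable]: "S \<in> borel_measurable ?M" unfolding S_def by simp
  have plus: "gauss_vector I (\<lambda>i. \<mu> i + a i) \<sigma> = density ?M (\<lambda>w. ennreal (exp (S w - ?N)))"
    using gauss_vector_density_shift[OF assms(1,2)] by (simp add: S_def)
  have minus: "gauss_vector I (\<lambda>i. \<mu> i - a i) \<sigma> = density ?M (\<lambda>w. ennreal (exp (- S w - ?N)))"
    using gauss_vector_density_shift[OF assms(1,2), of \<mu> "\<lambda>i. - a i"] by (simp add: S_def sum_negf)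
  have "2 * exp (- ?N) \<le> exp (s - ?N) + exp (- s - ?N)" for s :: real
  proof -
    have "0 \<le> (exp (s / 2) - exp (- s / 2))\<^sup>2" by simp
    also have "\<dots> = exp (2 * (s / 2)) + exp (2 * (- s / 2)) - 2 * (exp (s / 2) * exp (- s / 2))"
      unfolding exp_double power2_diff by simp
    also have "\<dots> = exp s + exp (- s) - 2" by (simp add: mult_exp_exp)
    finally have "2 * exp (- ?N) \<le> (exp s + exp (- s)) * exp (- ?N)"
      by (intro mult_right_mono) auto
    then show ?thesis by (simp add: distrib_right mult_exp_exp)
  qed
  then have "ennreal (2 * exp (- ?N)) * indicator E w
      \<le> ennreal (exp (S w - ?N)) * indicator E w + ennreal (exp (- S w - ?N)) * indicator E w" for w
    by (simp add: distrib_right[symmetric] ennreal_plus[symmetric] ennreal_leI mult_right_mono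
        del: ennreal_plus)
  then have "(\<integral>\<^sup>+w. ennreal (2 * exp (- ?N)) * indicator E w \<partial>?M)
      \<le> (\<integral>\<^sup>+w. ennreal (exp (S w - ?N)) * indicator E w + ennreal (exp (- S w - ?N)) * indicator E w \<partial>?M)"
    by (intro nn_integral_mono)
  also have "\<dots> = emeasure (gauss_vector I (\<lambda>i. \<mu> i + a i) \<sigma>) E + emeasure (gauss_vector I (\<lambda>i. \<mu> i - a i) \<sigma>) E"
    unfolding plus minus using E by (subst nn_integral_add) (auto simp: emeasure_density)
  finally show ?thesis using E by (simp add: nn_integral_cmult_indicator)
qed

text \<open>The measure of \<open>E\<close> under the law shifted by \<open>k\<close> steps is the
  probability of the preimage \<open>T k\<close>. A point in two such preimages would have two
  translates in \<open>E\<close> that differ by at least \<open>l\<close> along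
  \<open>v\<close>.\<close>

lemma sum_translates_le_1:
  assumes "finite I" "0 < \<sigma>" and E: "E \<in> sets (gauss_vector I \<mu> \<sigma>)" and l: "0 < l"
    and disj: "\<And>w s. w \<in> E \<Longrightarrow> l \<le> s \<Longrightarrow> (\<lambda>i\<in>I. w i + s * v i) \<notin> E" and r: "\<bar>r\<bar> = 1"
  shows "(\<Sum>k\<le>K. emeasure (gauss_vector I (\<lambda>i. \<mu> i + r * (real k * l * v i)) \<sigma>) E) \<le> 1"
proof -
  let ?M = "gauss_vector I \<mu> \<sigma>"
  interpret prob_space ?M by (rule prob_space_gauss_vector[OF assms(2)])
  define T where "T = (\<lambda>k::nat. (\<lambda>w. \<lambda>i\<in>I. w i + r * (real k * l * v i)) -` E \<inter> space ?M)"
  have T: "T k \<in> sets ?M" for k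
    unfolding T_def by (rule measurable_sets[OF measurable_translate E])
  have "T k \<inter> T h = {}" if "k < h" for k h
  proof -
    have "l * 1 \<le> l * (real h - real k)" using that l by (intro mult_left_mono) auto
    then have ge: "l \<le> l * (real h - real k)" by simp
    have *: "(\<lambda>i\<in>I. (\<lambda>i\<in>I. w i + r * (real k * l * v i)) i + l * (real h - real k) * v i)
        = (\<lambda>i\<in>I. w i + r * (real h * l * v i))" if "r = 1" for w :: "'a \<Rightarrow> real"
      using that by (auto simp: fun_eq_iff algebra_simps)
    \<comment> \<open>The hypothesis on \<open>E\<close> covers forward translations only. When
      stepping backwards, the translate with the larger index is the starting point.\<close>
    have **: "(\<lambda>i\<in>I. (\<lambda>i\<in>I. w i + r * (real h * l * v i)) i + l * (real h - real k) * v i)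
        = (\<lambda>i\<in>I. w i + r * (real k * l * v i))" if "r = - 1" for w :: "'a \<Rightarrow> real"
      using that by (auto simp: fun_eq_iff algebra_simps)
    show ?thesis
      using r disj[OF _ ge] * ** unfolding T_def by (cases "r = 1") (force simp: abs_if split: if_splits)+
  qed
  then have "disjoint_family_on T {..K}"
    unfolding disjoint_family_on_def by (metis Int_commute linorder_neqE_nat)
  then have "(\<Sum>k\<le>K. emeasure ?M (T k)) = emeasure ?M (\<Union>k\<le>K. T k)"
    using T by (intro sum_emeasure) auto
  also have "\<dots> \<le> 1" by (rule emeasure_le_1)
  finally have "(\<Sum>k\<le>K. emeasure ?M (T k)) \<le> 1" .
  moreover have "emeasure ?M (T k) = emeasure (gauss_vector I (\<lambda>i. \<mu> i + r * (real k * l * v i)) \<sigma>) E" for k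
    unfolding gauss_vector_shift[OF assms(1,2), symmetric] T_def
    by (rule emeasure_distr[symmetric, OF measurable_translate E])
  ultimately show ?thesis by simp
qed

text \<open>Translates of \<open>E\<close> by multiples of \<open>l v\<close> are disjoint, and as long as the translation is shorter than
  \<open>\<sigma>\<close> the measures of two opposite translates are on average at least a constant times the measure of \<open>E\<close>.\<close>
lemma gauss_vector_line_bound:
  assumes "finite I" "0 < \<sigma>" and E: "E \<in> sets (gauss_vector I \<mu> \<sigma>)" and l: "0 < l"
    and disj: "\<And>w s. w \<in> E \<Longrightarrow> l \<le> s \<Longrightarrow> (\<lambda>i\<in>I. w i + s * v i) \<notin> E"
    and W: "0 < W" "(\<Sum>i\<in>I. (v i)\<^sup>2) \<le> W\<^sup>2"
  shows "emeasure (gauss_vector I \<mu> \<sigma>) E \<le> ennreal (2 * l * W / \<sigma>)"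
proof -
  let ?M = "gauss_vector I \<mu> \<sigma>"
  interpret prob_space ?M by (rule prob_space_gauss_vector[OF assms(2)])
  \<comment> \<open>The largest number of steps for which the total shift, of length at most
    \<open>K * l * W\<close>, is bounded by \<open>\<sigma>\<close>.\<close>
  define K where "K = nat \<lfloor>\<sigma> / (l * W)\<rfloor>"
  have pos: "0 < \<sigma> / (l * W)" using assms by simp
  have K: "real K \<le> \<sigma> / (l * W)" "\<sigma> / (l * W) < real K + 1"
    using pos unfolding K_def by linarith+
  let ?p = "\<lambda>k::nat. emeasure (gauss_vector I (\<lambda>i. \<mu> i + 1 * (real k * l * v i)) \<sigma>) E"
  let ?q = "\<lambda>k::nat. emeasure (gauss_vector I (\<lambda>i. \<mu> i + (- 1) * (real k * l * v i)) \<sigma>) E"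
  have step: "emeasure ?M E \<le> ?p k + ?q k" if "k \<le> K" for k
  proof -
    let ?a = "\<lambda>i. real k * l * v i"
    have "real k * (l * W) \<le> \<sigma>"
      using that K(1) l W(1) by (simp add: pos_le_divide_eq) (smt (verit) mult_pos_pos mult_right_mono of_nat_mono)
    then have "(real k * (l * W))\<^sup>2 \<le> \<sigma>\<^sup>2" using l W(1) by (intro power_mono) auto
    have "(\<Sum>i\<in>I. (?a i)\<^sup>2) = (real k * l)\<^sup>2 * (\<Sum>i\<in>I. (v i)\<^sup>2)"
      by (simp add: sum_distrib_left power_mult_distrib)
    also have "\<dots> \<le> (real k * l)\<^sup>2 * W\<^sup>2" using W(2) by (intro mult_left_mono) auto
    also have "\<dots> \<le> \<sigma>\<^sup>2"
      using \<open>(real k * (l * W))\<^sup>2 \<le> \<sigma>\<^sup>2\<close> by (simp add: power_mult_distrib mult.assoc)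
    finally have "(\<Sum>i\<in>I. (?a i)\<^sup>2) / (2 * \<sigma>\<^sup>2) \<le> 1 / 2"
      using assms(2) by (simp add: divide_simps)
    \<comment> \<open>Makes the factor in the symmetric shift bound, which is at least
      \<open>2 * exp (- 1 / 2)\<close>, no smaller than 1.\<close>
    moreover have "exp (1 / 2 :: real) \<le> 2"
    proof -
      have "(exp (1 / 2 :: real))\<^sup>2 = exp 1" by (simp add: power2_eq_square mult_exp_exp)
      then have "(exp (1 / 2 :: real))\<^sup>2 \<le> 2\<^sup>2" using exp_le by simp
      then show ?thesis by (rule power2_le_imp_le) simp
    qed
    ultimately have "exp ((\<Sum>i\<in>I. (?a i)\<^sup>2) / (2 * \<sigma>\<^sup>2)) \<le> 2"
      by (meson exp_le_cancel_iff order_trans)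
    then have "1 \<le> 2 * exp (- (\<Sum>i\<in>I. (?a i)\<^sup>2) / (2 * \<sigma>\<^sup>2))"
      by (simp add: exp_minus field_simps)
    then have "1 * emeasure ?M E \<le> ennreal (2 * exp (- (\<Sum>i\<in>I. (?a i)\<^sup>2) / (2 * \<sigma>\<^sup>2))) * emeasure ?M E"
      by (intro mult_right_mono) (auto simp flip: ennreal_1 intro: ennreal_leI)
    also have "\<dots> \<le> ?p k + ?q k"
      using gauss_vector_symmetric_shift[OF assms(1-3), of ?a] by simp
    finally show ?thesis by simp
  qed
  \<comment> \<open>The shifts \<open>0, ..., K\<close> count \<open>E\<close> at least
    \<open>K + 1 > \<sigma> / (l * W)\<close> times, while each of the two directions contributes at
    most 1.\<close>
  have "of_nat (Suc K) * emeasure ?M E = (\<Sum>k\<le>K. emeasure ?M E)" by simp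
  also have "\<dots> \<le> (\<Sum>k\<le>K. ?p k + ?q k)" using step by (intro sum_mono) auto
  also have "\<dots> \<le> 1 + 1"
    unfolding sum.distrib
    using sum_translates_le_1[OF assms(1-5), where r = 1 and K = K]
      sum_translates_le_1[OF assms(1-5), where r = "- 1" and K = K]
    by (intro add_mono) auto
  finally have "of_nat (Suc K) * emeasure ?M E \<le> 2" by simp
  then have "ennreal (real (Suc K) * prob E) \<le> ennreal 2"
    by (simp add: emeasure_eq_measure ennreal_mult ennreal_of_nat_eq_real_of_nat del: of_nat_Suc)
  then have "real (Suc K) * prob E \<le> 2" by (subst (asm) ennreal_le_iff) auto
  then have "(real K + 1) * prob E \<le> 2" by (simp add: add.commute)
  then have "\<sigma> / (l * W) * prob E \<le> 2"
    using K(2) by (smt (verit) measure_nonneg mult_right_mono)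
  then have "prob E \<le> 2 * l * W / \<sigma>" using assms by (simp add: field_simps)
  then show ?thesis by (simp add: emeasure_eq_measure ennreal_leI)
qed

section \<open>Measurability of the exceptional events\<close>

text \<open>One point of \<open>K\<close> is chosen in each basic open set that meets
  \<open>K\<close>, so the subset is dense relative to \<open>K\<close> and lies inside it.\<close>

lemma countable_dense_subset:
  fixes K :: "'a::second_countable_topology set"
  obtains D where "countable D" "D \<subseteq> K" "\<And>U. open U \<Longrightarrow> U \<inter> K \<noteq> {} \<Longrightarrow> U \<inter> D \<noteq> {}"
proof -
  obtain B :: "'a set set" where B: "countable B" "topological_basis B"
    using ex_countable_basis by blast
  define D where "D = (\<lambda>U. SOME z. z \<in> U \<inter> K) ` {U\<in>B. U \<inter> K \<noteq> {}}"
  have D: "(SOME z. z \<in> U \<inter> K) \<in> U \<inter> K" if "U \<inter> K \<noteq> {}" for U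
    using that some_in_eq[of "U \<inter> K"] by simp
  show ?thesis
  proof
    show "countable D" 
      unfolding D_def using countable_subset[OF _ B(1)] by (intro countable_image) auto
    show "D \<subseteq> K"
    proof
      fix d assume "d \<in> D"
      then obtain U where "U \<inter> K \<noteq> {}" "d = (SOME z. z \<in> U \<inter> K)" unfolding D_def by auto
      with D show "d \<in> K" by simp
    qed
    fix U :: "'a set" assume "open U" "U \<inter> K \<noteq> {}"
    then obtain z where z: "z \<in> U" "z \<in> K" by blast
    obtain V where V: "V \<in> B" "z \<in> V" "V \<subseteq> U"
      by (rule topological_basisE[OF B(2) \<open>open U\<close> z(1)])
    have "V \<inter> K \<noteq> {}" using z(2) V(2) by blast
    then have "(SOME z. z \<in> V \<inter> K) \<in> D" using V(1) unfolding D_def by (intro imageI) auto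
    with D[OF \<open>V \<inter> K \<noteq> {}\<close>] V(3) show "U \<inter> D \<noteq> {}" by blast
  qed
qed

text \<open>By compactness, the existential quantifier can be replaced by approximate solutions in a countable
  dense subset of \<open>K\<close>.\<close>
lemma sets_Collect_ex_compact:
  fixes g :: "'w \<Rightarrow> 'z::second_countable_topology \<Rightarrow> real"
  assumes K: "compact K" and cont: "\<And>w. w \<in> space M \<Longrightarrow> continuous_on K (g w)"
    and meas: "\<And>z. z \<in> K \<Longrightarrow> (\<lambda>w. g w z) \<in> borel_measurable M"
  shows "{w\<in>space M. \<exists>z\<in>K. g w z \<le> 0} \<in> sets M"
proof -
  obtain D where D: "countable D" "D \<subseteq> K" "\<And>U. open U \<Longrightarrow> U \<inter> K \<noteq> {} \<Longrightarrow> U \<inter> D \<noteq> {}"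
    using countable_dense_subset[of K] by blast
  have "(\<exists>z\<in>K. g w z \<le> 0) \<longleftrightarrow> (\<forall>N::nat. \<exists>z\<in>D. g w z < 1 / (real N + 1))" if w: "w \<in> space M" for w
  proof
    assume "\<exists>z\<in>K. g w z \<le> 0"
    then obtain z where z: "z \<in> K" "g w z \<le> 0" by blast
    show "\<forall>N::nat. \<exists>z\<in>D. g w z < 1 / (real N + 1)"
    proof
      fix N :: nat
      obtain U where U: "open U" "U \<inter> K = g w -` {..<1 / (real N + 1)} \<inter> K"
        using cont[OF w, unfolded continuous_on_open_invariant, rule_format, OF open_lessThan] by blast
      have "0 < 1 / (real N + 1)" by simp
      with z(2) have "g w z < 1 / (real N + 1)" by linarith
      with z(1) have "z \<in> g w -` {..<1 / (real N + 1)} \<inter> K" by simp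
      then have "U \<inter> K \<noteq> {}" using U(2) by blast
      then obtain d where "d \<in> U" "d \<in> D" using D(3) U(1) by blast
      then show "\<exists>z\<in>D. g w z < 1 / (real N + 1)" using U(2) D(2) by blast
    qed
  next
    assume approx: "\<forall>N::nat. \<exists>z\<in>D. g w z < 1 / (real N + 1)"
    \<comment> \<open>On a compact set the infimum of \<open>g w\<close> is attained; it is at most
      every positive number, hence at most 0.\<close>
    then have "K \<noteq> {}" using D(2) by blast
    then obtain z where z: "z \<in> K" "\<And>u. u \<in> K \<Longrightarrow> g w z \<le> g w u"
      using continuous_attains_inf[OF K _ cont[OF w]] by blast
    have "g w z \<le> 0"
    proof (rule field_le_epsilon)
      fix e :: real assume "0 < e"
      then obtain N where "inverse (real (Suc N)) < e" using reals_Archimedean by blast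
      moreover obtain d where "d \<in> D" "g w d < 1 / (real N + 1)" using approx by blast
      ultimately show "g w z \<le> 0 + e"
        using z(2)[of d] D(2) by (auto simp: inverse_eq_divide add.commute)
    qed
    with z(1) show "\<exists>z\<in>K. g w z \<le> 0" by blast
  qed
  then have "{w\<in>space M. \<exists>z\<in>K. g w z \<le> 0}
      = {w\<in>space M. \<forall>N::nat. \<exists>z\<in>D. g w z < 1 / (real N + 1)}"
    by blast
  also have "\<dots> \<in> sets M"
  proof (intro sets.sets_Collect sets.sets_Collect_countable_Ex' D(1))
    fix N :: nat and z assume "z \<in> D"
    then have [measurable]: "(\<lambda>w. g w z) \<in> borel_measurable M" using meas D(2) by blast
    show "{w\<in>space M. g w z < 1 / (real N + 1)} \<in> sets M" by measurable
  qed
  finally show ?thesis .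
qed

text \<open>All coordinates are constrained, also those beyond the dimension of the program, so that
  Tychonoff's theorem gives compactness in the product topology.\<close>

definition coordinate_box :: "real \<Rightarrow> (nat \<Rightarrow> real) set" where
  "coordinate_box R = {z. \<forall>i. \<bar>z i\<bar> \<le> R}"

lemma compact_coordinate_box: "compact (coordinate_box R)"
proof -
  have "coordinate_box R = Pi\<^sub>E UNIV (\<lambda>_. {- R..R})"
    by (auto simp: coordinate_box_def PiE_UNIV_domain abs_le_iff minus_le_iff)
  moreover have "compactin (product_topology (\<lambda>_. euclidean) UNIV) (Pi\<^sub>E UNIV (\<lambda>_::nat. {- R..R}))"
    by (subst compactin_PiE) auto
  ultimately show ?thesis
    by (simp add: euclidean_product_topology)
qed

lemma box_truncation:
  fixes x :: "nat \<Rightarrow> real"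
  shows "\<exists>x' R0. (\<forall>i<n. x' i = x i) \<and> (\<forall>R\<ge>R0. x' \<in> coordinate_box R)"
proof (intro exI conjI allI impI)
  fix R assume R: "(\<Sum>i<n. \<bar>x i\<bar>) \<le> R"
  have "\<bar>if i < n then x i else 0\<bar> \<le> R" for i
  proof (cases "i < n")
    case True
    then have "\<bar>x i\<bar> \<le> (\<Sum>i<n. \<bar>x i\<bar>)" by (intro member_le_sum) auto
    with R True show ?thesis by simp
  next
    case False
    have "0 \<le> (\<Sum>i<n. \<bar>x i\<bar>)" by (intro sum_nonneg) auto
    with R have "0 \<le> R" by (rule order_trans[rotated])
    with False show ?thesis by simp
  qed
  then show "(\<lambda>i. if i < n then x i else 0) \<in> coordinate_box R" by (simp add: coordinate_box_def)
qed auto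

text \<open>Countably many compact boxes suffice: \<open>P\<close> sees only the first coordinates,
  so the others may be set to 0, and the truncated points lie in every large box.\<close>

lemma ex_box_iff:
  assumes cong: "\<And>x x' y. (\<And>i. i < n \<Longrightarrow> x i = x' i) \<Longrightarrow> P x y \<Longrightarrow> P x' y"
    "\<And>x y y'. (\<And>j. j < m \<Longrightarrow> y j = y' j) \<Longrightarrow> P x y \<Longrightarrow> P x y'"
  shows "(\<exists>x y. P x y) \<longleftrightarrow> (\<exists>R::nat. \<exists>z\<in>coordinate_box R \<times> coordinate_box R. P (fst z) (snd z))"
proof
  assume "\<exists>x y. P x y"
  then obtain x y where "P x y" by blast
  moreover obtain x' R1 where x': "\<forall>i<n. x' i = x i" "\<forall>R\<ge>R1. x' \<in> coordinate_box R" using box_truncation by blast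
  moreover obtain y' R2 where y': "\<forall>j<m. y' j = y j" "\<forall>R\<ge>R2. y' \<in> coordinate_box R" using box_truncation by blast
  ultimately have "P x' y'" using cong(1)[of x x' y] cong(2)[of y y' x'] by simp
  moreover obtain R :: nat where "max R1 R2 \<le> R" using real_arch_simple by blast
  ultimately show "\<exists>R::nat. \<exists>z\<in>coordinate_box R \<times> coordinate_box R. P (fst z) (snd z)"
    using x'(2) y'(2) by (intro exI[of _ R] bexI[of _ "(x', y')"]) auto
qed auto

section \<open>Measurability in the data and continuity in the unknowns\<close>

definition random_lp where
  "random_lp M m n A b c \<longleftrightarrow>
    (\<forall>j<m. \<forall>i<n. (\<lambda>w. A w j i :: real) \<in> borel_measurable M) \<and>
    (\<forall>j<m. (\<lambda>w. b w j :: real) \<in> borel_measurable M) \<and>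
    (\<forall>i<n. (\<lambda>w. c w i :: real) \<in> borel_measurable M)"

lemma random_lp_transpose:
  "random_lp M m n A b c \<Longrightarrow> random_lp M n m (\<lambda>w i j. - A w j i) (\<lambda>w i. - c w i) (\<lambda>w j. - b w j)"
  by (simp add: random_lp_def)

context
  fixes M :: "'w measure" and m n :: nat and A :: "'w \<Rightarrow> nat \<Rightarrow> nat \<Rightarrow> real" and b c
  assumes lp: "random_lp M m n A b c"
begin

lemma measurable_data:
  "j < m \<Longrightarrow> i < n \<Longrightarrow> (\<lambda>w. A w j i) \<in> borel_measurable M"
  "j < m \<Longrightarrow> (\<lambda>w. b w j) \<in> borel_measurable M"
  "i < n \<Longrightarrow> (\<lambda>w. c w i) \<in> borel_measurable M"
  using lp by (auto simp: random_lp_def)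

lemma measurable_objective:
  "(\<lambda>w. objective n (c w) x) \<in> borel_measurable M" "(\<lambda>w. objective m (b w) y) \<in> borel_measurable M"
  unfolding objective_def using measurable_data by auto

lemma measurable_scheme_value:
  "k \<in> scheme_index m n \<Longrightarrow> (\<lambda>w. scheme_value n (A w) (b w) x k) \<in> borel_measurable M"
  unfolding scheme_value_def using measurable_data by (cases k) auto

lemma measurable_dual_value:
  "k \<in> scheme_index m n \<Longrightarrow> (\<lambda>w. dual_value m (A w) (c w) y k) \<in> borel_measurable M"
  unfolding dual_value_def using measurable_data by (cases k) auto

end

context
  fixes S :: "'z::topological_space set" and f :: "'z \<Rightarrow> nat \<Rightarrow> real"
  assumes f: "continuous_on S f"
begin

lemma continuous_on_objective: "continuous_on S (\<lambda>z. objective n c (f z))"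
  unfolding objective_def
  by (intro continuous_on_sum continuous_on_mult continuous_on_const
      continuous_on_product_then_coordinatewise[OF f])

lemma continuous_on_scheme_value: "continuous_on S (\<lambda>z. scheme_value n A b (f z) k)"
  unfolding scheme_value_def
  by (cases k) (auto intro!: continuous_on_sum continuous_on_mult continuous_on_diff continuous_on_const
      continuous_on_product_then_coordinatewise[OF f])

lemma continuous_on_dual_value: "continuous_on S (\<lambda>z. dual_value m A c (f z) k)"
  unfolding dual_value_def
  by (cases k) (auto intro!: continuous_on_sum continuous_on_mult continuous_on_diff continuous_on_const
      continuous_on_product_then_coordinatewise[OF f])

end

text \<open>A continuous nonnegative penalty that vanishes exactly on the feasible points, so that
  feasibility becomes a condition of the form \<open>g \<le> 0\<close>.\<close>

definition primal_violation where
  "primal_violation m n A b x = (\<Sum>k\<in>scheme_index m n. max 0 (- scheme_value n A b x k))"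

definition dual_violation where
  "dual_violation m n A c y = (\<Sum>k\<in>scheme_index m n. max 0 (- dual_value m A c y k))"

lemma violation_nonneg: "0 \<le> primal_violation m n A b x" "0 \<le> dual_violation m n A c y"
  unfolding primal_violation_def dual_violation_def by (auto intro: sum_nonneg)

lemma violation_eq_0_iff:
  "primal_violation m n A b x = 0 \<longleftrightarrow> primal_feasible m n A b x"
  "dual_violation m n A c y = 0 \<longleftrightarrow> dual_feasible m n A c y"
proof -
  have "max 0 (- a) = 0 \<longleftrightarrow> 0 \<le> a" for a :: real by (auto simp: max_def)
  then show "primal_violation m n A b x = 0 \<longleftrightarrow> primal_feasible m n A b x"
    "dual_violation m n A c y = 0 \<longleftrightarrow> dual_feasible m n A c y"
    unfolding primal_violation_def dual_violation_def primal_feasible_iff dual_feasible_iff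
    by (subst sum_nonneg_eq_0_iff; simp)+
qed

lemma measurable_violation:
  assumes "random_lp M m n A b c"
  shows "(\<lambda>w. primal_violation m n (A w) (b w) x) \<in> borel_measurable M"
    "(\<lambda>w. dual_violation m n (A w) (c w) y) \<in> borel_measurable M"
  unfolding primal_violation_def dual_violation_def
  using measurable_scheme_value[OF assms] measurable_dual_value[OF assms]
  by (auto intro!: borel_measurable_sum borel_measurable_max)

lemma continuous_on_violation:
  "continuous_on S f \<Longrightarrow> continuous_on S (\<lambda>z. primal_violation m n A b (f z))"
  "continuous_on S f \<Longrightarrow> continuous_on S (\<lambda>z. dual_violation m n A c (f z))"
  unfolding primal_violation_def dual_violation_def
  by (auto intro!: continuous_on_sum continuous_on_max continuous_on_const continuous_on_minus
      continuous_on_scheme_value continuous_on_dual_value)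

lemma coordinate_congs:
  assumes "\<And>i. i < n \<Longrightarrow> x i = x' i"
  shows "objective n c x = objective n c x'"
    "primal_feasible m n A b x \<longleftrightarrow> primal_feasible m n A b x'"
    "dual_feasible n l A' c' x \<longleftrightarrow> dual_feasible n l A' c' x'"
    "k \<in> scheme_index m n \<Longrightarrow> scheme_value n A b x k = scheme_value n A b x' k"
    "k \<in> scheme_index n l \<Longrightarrow> dual_value n A' c' x k = dual_value n A' c' x' k"
  using assms
  by (auto simp: objective_def primal_feasible_def dual_feasible_def scheme_value_def dual_value_def
      scheme_index_def)

text \<open>Feasibility, the gap bound and the extra condition \<open>f \<le> 0\<close> are merged
  into one penalty that is 0 exactly at the wanted pairs. Each box then falls under the compactness
  lemma, and the boxes are united over all integer radii.\<close>

lemma sets_near_optimal: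
  assumes lp: "random_lp M m n A b c"
    and meas: "\<And>x y. (\<lambda>w. f w x y :: real) \<in> borel_measurable M"
    and cont: "\<And>w S. continuous_on S (\<lambda>z. f w (fst z) (snd z))"
    and cong: "\<And>w x x' y y'. (\<And>i. i < n \<Longrightarrow> x i = x' i) \<Longrightarrow> (\<And>j. j < m \<Longrightarrow> y j = y' j) \<Longrightarrow> f w x y = f w x' y'"
  shows "{w\<in>space M. \<exists>x y. primal_feasible m n (A w) (b w) x \<and> dual_feasible m n (A w) (c w) y \<and>
    objective m (b w) y - objective n (c w) x \<le> d \<and> f w x y \<le> 0} \<in> sets M"
proof -
  let ?P = "\<lambda>w x y. primal_feasible m n (A w) (b w) x \<and> dual_feasible m n (A w) (c w) y \<and>
    objective m (b w) y - objective n (c w) x \<le> d \<and> f w x y \<le> 0"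
  define g where "g = (\<lambda>w (z :: (nat \<Rightarrow> real) \<times> (nat \<Rightarrow> real)).
    primal_violation m n (A w) (b w) (fst z) + dual_violation m n (A w) (c w) (snd z)
    + max 0 (objective m (b w) (snd z) - objective n (c w) (fst z) - d) + max 0 (f w (fst z) (snd z)))"
  have P_iff: "?P w (fst z) (snd z) \<longleftrightarrow> g w z \<le> 0" for w z
    unfolding g_def violation_eq_0_iff[symmetric]
    using violation_nonneg(1)[of m n "A w" "b w" "fst z"] violation_nonneg(2)[of m n "A w" "c w" "snd z"]
    by (auto simp: max_def)
  have ex: "(\<exists>x y. ?P w x y) \<longleftrightarrow> (\<exists>R::nat. \<exists>z\<in>coordinate_box R \<times> coordinate_box R. g w z \<le> 0)" for w
    unfolding P_iff[symmetric]
  proof (rule ex_box_iff)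
    fix x x' y assume "\<And>i. i < n \<Longrightarrow> x i = x' i" "?P w x y"
    then show "?P w x' y" using coordinate_congs(1,2)[of n x x'] cong[of x x' y y w] by simp
  next
    fix x y y' assume "\<And>j. j < m \<Longrightarrow> y j = y' j" "?P w x y"
    then show "?P w x y'" using coordinate_congs(1,3)[of m y y'] cong[of x x y y' w] by simp
  qed
  have "{w\<in>space M. \<exists>z\<in>coordinate_box R \<times> coordinate_box R. g w z \<le> 0} \<in> sets M" for R
  proof (rule sets_Collect_ex_compact)
    show "compact (coordinate_box R \<times> coordinate_box R)" by (intro compact_Times compact_coordinate_box)
    show "continuous_on (coordinate_box R \<times> coordinate_box R) (g w)" for w
      unfolding g_def
      by (intro continuous_on_add continuous_on_max continuous_on_diff continuous_on_const
          continuous_on_violation continuous_on_objective cont continuous_on_fst continuous_on_snd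
          continuous_on_id)
    show "(\<lambda>w. g w z) \<in> borel_measurable M" for z
      unfolding g_def using measurable_violation[OF lp] measurable_objective[OF lp] meas by simp
  qed
  then have "(\<Union>R::nat. {w\<in>space M. \<exists>z\<in>coordinate_box R \<times> coordinate_box R. g w z \<le> 0}) \<in> sets M" by blast
  also have "(\<Union>R::nat. {w\<in>space M. \<exists>z\<in>coordinate_box R \<times> coordinate_box R. g w z \<le> 0}) = {w\<in>space M. \<exists>x y. ?P w x y}"
    unfolding ex by blast
  finally show ?thesis .
qed

lemma sets_near_opt_split:
  assumes lp: "random_lp M m n A b c" and k: "k \<in> scheme_index m n"
  shows "{w\<in>space M. near_opt_split m n (A w) (b w) (c w) k p q d} \<in> sets M"
proof -
  note [measurable] = measurable_scheme_value[OF lp k]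
  have cont: "continuous_on S (\<lambda>z. scheme_value n (A w) (b w) (fst z) k)"
    for w and S :: "((nat \<Rightarrow> real) \<times> (nat \<Rightarrow> real)) set"
    by (intro continuous_on_scheme_value continuous_on_fst continuous_on_id)
  have "{w\<in>space M. \<exists>x y. primal_feasible m n (A w) (b w) x \<and> dual_feasible m n (A w) (c w) y \<and>
      objective m (b w) y - objective n (c w) x \<le> d \<and> scheme_value n (A w) (b w) x k - p \<le> 0} \<in> sets M"
  proof (rule sets_near_optimal[OF lp])
    show "continuous_on S (\<lambda>z. scheme_value n (A w) (b w) (fst z) k - p)"
      for w and S :: "((nat \<Rightarrow> real) \<times> (nat \<Rightarrow> real)) set"
      by (intro continuous_on_diff cont continuous_on_const)
    show "scheme_value n (A w) (b w) x k - p = scheme_value n (A w) (b w) x' k - p"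
      if "\<And>i. i < n \<Longrightarrow> x i = x' i" "\<And>j. j < m \<Longrightarrow> y j = y' j"
      for w and x x' y y' :: "nat \<Rightarrow> real"
      using coordinate_congs(4)[OF that(1) k] by simp
  qed simp_all
  moreover have "{w\<in>space M. \<exists>x y. primal_feasible m n (A w) (b w) x \<and> dual_feasible m n (A w) (c w) y \<and>
      objective m (b w) y - objective n (c w) x \<le> d \<and> q - scheme_value n (A w) (b w) x k \<le> 0} \<in> sets M"
  proof (rule sets_near_optimal[OF lp])
    show "continuous_on S (\<lambda>z. q - scheme_value n (A w) (b w) (fst z) k)"
      for w and S :: "((nat \<Rightarrow> real) \<times> (nat \<Rightarrow> real)) set"
      by (intro continuous_on_diff cont continuous_on_const)
    show "q - scheme_value n (A w) (b w) x k = q - scheme_value n (A w) (b w) x' k"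
      if "\<And>i. i < n \<Longrightarrow> x i = x' i" "\<And>j. j < m \<Longrightarrow> y j = y' j"
      for w and x x' y y' :: "nat \<Rightarrow> real"
      using coordinate_congs(4)[OF that(1) k] by simp
  qed simp_all
  ultimately show ?thesis
    unfolding near_opt_split_def diff_le_0_iff_le by (intro sets.sets_Collect_conj)
qed

lemma sets_near_degenerate:
  assumes lp: "random_lp M m n A b c" and k: "k \<in> scheme_index m n"
  shows "{w\<in>space M. near_degenerate m n (A w) (b w) (c w) k \<eta>} \<in> sets M"
proof -
  note [measurable] = measurable_scheme_value[OF lp k] measurable_dual_value[OF lp k]
  \<comment> \<open>The maximum merges the conditions on the dual and on the primal value into the
    single extra condition \<open>f \<le> 0\<close>.\<close>
  have "{w\<in>space M. \<exists>x y. primal_feasible m n (A w) (b w) x \<and> dual_feasible m n (A w) (c w) y \<and>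
      objective m (b w) y - objective n (c w) x \<le> 0 \<and>
      max (dual_value m (A w) (c w) y k) (scheme_value n (A w) (b w) x k - \<eta>) \<le> 0} \<in> sets M"
  proof (rule sets_near_optimal[OF lp])
    show "continuous_on S (\<lambda>z. max (dual_value m (A w) (c w) (snd z) k) (scheme_value n (A w) (b w) (fst z) k - \<eta>))"
      for w and S :: "((nat \<Rightarrow> real) \<times> (nat \<Rightarrow> real)) set"
      by (intro continuous_on_max continuous_on_diff continuous_on_scheme_value continuous_on_dual_value
          continuous_on_fst continuous_on_snd continuous_on_id continuous_on_const)
    show "max (dual_value m (A w) (c w) y k) (scheme_value n (A w) (b w) x k - \<eta>) = max (dual_value m (A w) (c w) y' k) (scheme_value n (A w) (b w) x' k - \<eta>)"
      if "\<And>i. i < n \<Longrightarrow> x i = x' i" "\<And>j. j < m \<Longrightarrow> y j = y' j"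
      for w and x x' y y' :: "nat \<Rightarrow> real"
      using coordinate_congs(4)[OF that(1) k] coordinate_congs(5)[OF that(2) k] by simp
  qed simp_all
  then show ?thesis unfolding near_degenerate_def by simp
qed

lemma sets_not_unique_primal:
  assumes lp: "random_lp M m n A b c"
  shows "{w\<in>space M. \<not> unique_primal m n (A w) (b w) (c w)} \<in> sets M"
proof -
  have "{w\<in>space M. \<not> unique_primal m n (A w) (b w) (c w)} = (\<Union>i\<in>{..<n}. \<Union>p\<in>\<rat>. \<Union>q\<in>\<rat> \<inter> {p<..}.
      {w\<in>space M. near_opt_split m n (A w) (b w) (c w) (Inl i) p q 0})"
    unfolding not_unique_primal_iff by auto
  also have "\<dots> \<in> sets M"
    using sets_near_opt_split[OF lp]
    by (intro sets.countable_UN'' countable_rat countable_Int1 countable_finite) auto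
  finally show ?thesis .
qed

lemma sets_ill_conditioned:
  assumes lp: "random_lp M m n A b c"
  shows "{w\<in>space M. ill_conditioned m n (A w) (b w) (c w) \<epsilon>} \<in> sets M"
proof -
  have "{w\<in>space M. ill_conditioned m n (A w) (b w) (c w) \<epsilon>}
      = {w\<in>space M. \<not> unique_primal m n (A w) (b w) (c w)} \<union>
        {w\<in>space M. \<not> unique_dual m n (A w) (b w) (c w)} \<union>
        (\<Union>k\<in>scheme_index m n. {w\<in>space M. near_degenerate m n (A w) (b w) (c w) k (2 * sqrt \<epsilon>)} \<union>
          {w\<in>space M. near_opt_split m n (A w) (b w) (c w) k 0 (sqrt \<epsilon>) \<epsilon>} \<union>
          {w\<in>space M. near_opt_split m n (A w) (b w) (c w) k (sqrt \<epsilon>) (2 * sqrt \<epsilon>) \<epsilon>})"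
    unfolding ill_conditioned_def by blast
  also have "\<dots> \<in> sets M"
    using sets_not_unique_primal[OF lp] sets_not_unique_primal[OF random_lp_transpose[OF lp]]
      sets_near_degenerate[OF lp] sets_near_opt_split[OF lp]
    by (intro sets.Un sets.finite_UN finite_scheme_index)
  finally show ?thesis .
qed

section \<open>Probability of ill-conditioning\<close>

text \<open>A common bound for the length of all gradients and relaxation directions. The summand 1
  covers the unit vectors and ensures positivity; the entrywise sum makes the expectation easy to
  bound.\<close>

definition data_size :: "nat \<Rightarrow> nat \<Rightarrow> (nat \<Rightarrow> nat \<Rightarrow> real) \<Rightarrow> real" where
  "data_size m n A = 1 + (\<Sum>j<m. \<Sum>i<n. \<bar>A j i\<bar>)"

lemma data_size_ge_1: "1 \<le> data_size m n A"
  unfolding data_size_def by (auto intro!: sum_nonneg)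

lemma sum_squares_le: "(\<Sum>i\<in>I. (f i)\<^sup>2) \<le> (\<Sum>i\<in>I. \<bar>f i\<bar>)\<^sup>2" for f :: "'a \<Rightarrow> real"
proof -
  have "(\<Sum>i\<in>I. (f i)\<^sup>2) = (L2_set f I)\<^sup>2" by (simp add: L2_set_def sum_nonneg)
  also have "\<dots> \<le> (\<Sum>i\<in>I. \<bar>f i\<bar>)\<^sup>2"
    by (intro power_mono L2_set_le_sum_abs) (simp add: L2_set_def sum_nonneg)
  finally show ?thesis .
qed

lemma slack_gradient_norm:
  assumes "k \<in> scheme_index m n"
  shows "(\<Sum>i<n. (slack_gradient A k i)\<^sup>2) \<le> (data_size m n A)\<^sup>2"
proof -
  have "(\<Sum>i<n. \<bar>slack_gradient A k i\<bar>) \<le> data_size m n A"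
    using assms
  proof (cases rule: scheme_index_cases)
    case (1 i)
    then show ?thesis using data_size_ge_1[of m n A] by (simp add: slack_gradient_def of_bool_def if_distrib cong: if_cong)
  next
    case (2 j)
    have "(\<Sum>i<n. \<bar>A j i\<bar>) \<le> (\<Sum>j<m. \<Sum>i<n. \<bar>A j i\<bar>)"
      using 2 by (intro member_le_sum[of j _ "\<lambda>j. \<Sum>i<n. \<bar>A j i\<bar>"]) (auto intro: sum_nonneg)
    then show ?thesis using 2 by (simp add: slack_gradient_def data_size_def)
  qed
  then have "(\<Sum>i<n. \<bar>slack_gradient A k i\<bar>)\<^sup>2 \<le> (data_size m n A)\<^sup>2"
    by (intro power_mono) (auto intro: sum_nonneg)
  then show ?thesis using sum_squares_le by (rule order_trans[rotated])
qed

lemma relaxation_direction_norm: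
  assumes "k \<in> scheme_index m n"
  shows "(\<Sum>j<m. (relaxation_direction A k j)\<^sup>2) \<le> (data_size m n A)\<^sup>2"
proof -
  have "(\<Sum>j<m. \<bar>relaxation_direction A k j\<bar>) \<le> data_size m n A"
    using assms
  proof (cases rule: scheme_index_cases)
    case (1 i)
    have "\<bar>A j i\<bar> \<le> (\<Sum>i<n. \<bar>A j i\<bar>)" for j
      using 1 by (intro member_le_sum[of i _ "\<lambda>i. \<bar>A j i\<bar>"]) auto
    then have "(\<Sum>j<m. \<bar>A j i\<bar>) \<le> (\<Sum>j<m. \<Sum>i<n. \<bar>A j i\<bar>)" by (intro sum_mono)
    then show ?thesis using 1 by (simp add: relaxation_direction_def data_size_def)
  next
    case (2 j)
    then show ?thesis using data_size_ge_1[of m n A] by (simp add: relaxation_direction_def of_bool_def if_distrib cong: if_cong)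
  qed
  then have "(\<Sum>j<m. \<bar>relaxation_direction A k j\<bar>)\<^sup>2 \<le> (data_size m n A)\<^sup>2"
    by (intro power_mono) (auto intro: sum_nonneg)
  then show ?thesis using sum_squares_le by (rule order_trans[rotated])
qed

text \<open>The sign \<open>r\<close> allows the objective of the dual program, which is \<open>- b\<close>.\<close>
lemma emeasure_near_opt_split_le:
  assumes \<sigma>: "0 < \<sigma>" and k: "k \<in> scheme_index m n" and l: "0 < l" "2 * d < l * (q - p)"
    and r: "\<bar>r\<bar> = 1" and p: "p < q"
  shows "emeasure (gauss_vector {..<n} \<mu> \<sigma>)
      {w\<in>space (gauss_vector {..<n} \<mu> \<sigma>). near_opt_split m n A b (\<lambda>i. r * w i) k p q d}
    \<le> ennreal (2 * l * data_size m n A / \<sigma>)"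
proof (rule gauss_vector_line_bound[where v = "\<lambda>i. r * slack_gradient A k i"])
  let ?M = "gauss_vector {..<n} \<mu> \<sigma>"
  \<comment> \<open>Moving \<open>w\<close> by \<open>s * r\<close> times the gradient moves the
    objective \<open>r * w\<close> by exactly \<open>s\<close> times the gradient.\<close>
  have rr: "r * r = 1" using r by (auto simp: abs_if split: if_splits)
  have "random_lp ?M m n (\<lambda>_. A) (\<lambda>_. b) (\<lambda>w i. r * w i)" by (simp add: random_lp_def)
  then show "{w\<in>space ?M. near_opt_split m n A b (\<lambda>i. r * w i) k p q d} \<in> sets ?M"
    using k by (rule sets_near_opt_split)
  fix w s
  assume w: "w \<in> {w\<in>space ?M. near_opt_split m n A b (\<lambda>i. r * w i) k p q d}" and s: "l \<le> s"
  show "(\<lambda>i\<in>{..<n}. w i + s * (r * slack_gradient A k i))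
      \<notin> {w\<in>space ?M. near_opt_split m n A b (\<lambda>i. r * w i) k p q d}"
  proof
    assume "(\<lambda>i\<in>{..<n}. w i + s * (r * slack_gradient A k i))
      \<in> {w\<in>space ?M. near_opt_split m n A b (\<lambda>i. r * w i) k p q d}"
    then have split: "near_opt_split m n A b (\<lambda>i. r * (\<lambda>i\<in>{..<n}. w i + s * (r * slack_gradient A k i)) i) k p q d"
      by simp
    have "s * (q - p) \<le> 2 * d"
    proof (rule near_opt_split_shift[OF _ split k])
      show "near_opt_split m n A b (\<lambda>i. r * w i) k p q d" using w by simp
      show "r * (\<lambda>i\<in>{..<n}. w i + s * (r * slack_gradient A k i)) i = r * w i + s * slack_gradient A k i"
        if "i < n" for i
      proof -
        have "r * (\<lambda>i\<in>{..<n}. w i + s * (r * slack_gradient A k i)) i = r * w i + (r * r) * (s * slack_gradient A k i)"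
          using that by (simp add: algebra_simps)
        then show ?thesis by (simp add: rr)
      qed
      show "0 \<le> s" using s l by simp
    qed
    moreover have "l * (q - p) \<le> s * (q - p)" using s p by (intro mult_right_mono) auto
    ultimately show False using l by linarith
  qed
next
  show "0 < data_size m n A" using data_size_ge_1[of m n A] by linarith
  have "r\<^sup>2 = 1" using r by (metis power2_abs one_power2)
  then show "(\<Sum>i<n. (r * slack_gradient A k i)\<^sup>2) \<le> (data_size m n A)\<^sup>2"
    using slack_gradient_norm[OF k, of A] by (simp add: power_mult_distrib)
qed (use \<sigma> l in auto)

text \<open>Uniqueness is part of the event because the shift argument identifies the relaxed
  optimum through it. Programs without uniqueness are discarded separately, using the randomness of
  \<open>c\<close>.\<close>

lemma emeasure_near_degenerate_le:
  assumes \<sigma>: "0 < \<sigma>" and k: "k \<in> scheme_index m n" and l: "0 < l" "\<eta> < l"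
  shows "emeasure (gauss_vector {..<m} \<mu> \<sigma>)
      {w\<in>space (gauss_vector {..<m} \<mu> \<sigma>). near_degenerate m n A w c k \<eta> \<and> unique_primal m n A w c}
    \<le> ennreal (2 * l * data_size m n A / \<sigma>)"
proof (rule gauss_vector_line_bound[where v = "relaxation_direction A k"])
  let ?M = "gauss_vector {..<m} \<mu> \<sigma>"
  have lp: "random_lp ?M m n (\<lambda>_. A) (\<lambda>w. w) (\<lambda>_. c)" by (simp add: random_lp_def)
  have "{w\<in>space ?M. near_degenerate m n A w c k \<eta> \<and> unique_primal m n A w c}
      = {w\<in>space ?M. near_degenerate m n A w c k \<eta>} - {w\<in>space ?M. \<not> unique_primal m n A w c}"
    by blast
  then show "{w\<in>space ?M. near_degenerate m n A w c k \<eta> \<and> unique_primal m n A w c} \<in> sets ?M"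
    using sets_near_degenerate[OF lp k, of \<eta>] sets_not_unique_primal[OF lp] by simp
  fix w s
  assume w: "w \<in> {w\<in>space ?M. near_degenerate m n A w c k \<eta> \<and> unique_primal m n A w c}" and s: "l \<le> s"
  show "(\<lambda>j\<in>{..<m}. w j + s * relaxation_direction A k j)
      \<notin> {w\<in>space ?M. near_degenerate m n A w c k \<eta> \<and> unique_primal m n A w c}"
  proof
    assume "(\<lambda>j\<in>{..<m}. w j + s * relaxation_direction A k j)
      \<in> {w\<in>space ?M. near_degenerate m n A w c k \<eta> \<and> unique_primal m n A w c}"
    then have shifted: "near_degenerate m n A (\<lambda>j\<in>{..<m}. w j + s * relaxation_direction A k j) c k \<eta>"
      "unique_primal m n A (\<lambda>j\<in>{..<m}. w j + s * relaxation_direction A k j) c"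
      by blast+
    have "s \<le> \<eta>"
    proof (rule near_degenerate_shift[OF _ shifted k])
      show "near_degenerate m n A w c k \<eta>" using w by blast
    qed (use s l in auto)
    with s l show False by linarith
  qed
next
  show "0 < data_size m n A" using data_size_ge_1[of m n A] by linarith
  show "(\<Sum>j<m. (relaxation_direction A k j)\<^sup>2) \<le> (data_size m n A)\<^sup>2"
    by (rule relaxation_direction_norm[OF k])
qed (use \<sigma> l in auto)

text \<open>For gap 0 the recurrence length can be taken arbitrarily small, so every split between
  fixed rational thresholds is null, and there are countably many of them.\<close>

lemma emeasure_not_unique_primal:
  assumes \<sigma>: "0 < \<sigma>" and r: "\<bar>r\<bar> = 1"
  shows "emeasure (gauss_vector {..<n} \<mu> \<sigma>)
    {w\<in>space (gauss_vector {..<n} \<mu> \<sigma>). \<not> unique_primal m n A b (\<lambda>i. r * w i)} = 0"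
proof -
  let ?M = "gauss_vector {..<n} \<mu> \<sigma>"
  let ?E = "\<lambda>i p q. {w\<in>space ?M. near_opt_split m n A b (\<lambda>i. r * w i) (Inl i) p q 0}"
  have lp: "random_lp ?M m n (\<lambda>_. A) (\<lambda>_. b) (\<lambda>w i. r * w i)" by (simp add: random_lp_def)
  have null: "?E i p q \<in> null_sets ?M" if "i < n" "p < q" for i p q
  proof -
    have k: "Inl i \<in> scheme_index m n" using that by simp
    have "emeasure ?M (?E i p q) \<le> ennreal 0 + ennreal e" if "0 < e" for e
    proof -
      \<comment> \<open>Chosen to make the line bound equal to \<open>e\<close>.\<close>
      define l where "l = e * \<sigma> / (2 * data_size m n A)"
      have "0 < data_size m n A" using data_size_ge_1[of m n A] by linarith
      then have l: "0 < l" "2 * l * data_size m n A / \<sigma> = e"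
        using \<sigma> \<open>0 < e\<close> by (simp_all add: l_def)
      have "emeasure ?M (?E i p q) \<le> ennreal (2 * l * data_size m n A / \<sigma>)"
      proof (rule emeasure_near_opt_split_le[OF \<sigma> k l(1) _ r \<open>p < q\<close>])
        show "2 * 0 < l * (q - p)" using l(1) \<open>p < q\<close> by simp
      qed
      also have "\<dots> = ennreal 0 + ennreal e" by (simp only: l(2) ennreal_0 add_0)
      finally show ?thesis .
    qed
    then have "emeasure ?M (?E i p q) \<le> ennreal 0" by (rule ennreal_le_epsilon) simp
    then show ?thesis
      using sets_near_opt_split[OF lp k] by (intro null_setsI) auto
  qed
  have "{w\<in>space ?M. \<not> unique_primal m n A b (\<lambda>i. r * w i)} = (\<Union>i\<in>{..<n}. \<Union>p\<in>\<rat>. \<Union>q\<in>\<rat> \<inter> {p<..}. ?E i p q)"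
    unfolding not_unique_primal_iff by auto
  also have "\<dots> \<in> null_sets ?M"
    using null by (intro null_sets_UN' countable_rat countable_Int1 countable_finite) auto
  finally show ?thesis by auto
qed

section \<open>Bounds on the entries of the matrix\<close>

text \<open>An entry is a coordinate of the image of a unit vector. The images of the unit ball are
  bounded first, so that the real supremum in \<open>mat_op_norm\<close> dominates each of
  them.\<close>

lemma abs_entry_le_1:
  assumes "mat_op_norm m n A \<le> 1" "j < m" "i < n"
  shows "\<bar>A j i\<bar> \<le> 1"
proof -
  let ?S = "{x. vec_norm n x \<le> 1}"
  have coord: "\<bar>v i\<bar> \<le> vec_norm l v" if "i < l" for i l and v :: "nat \<Rightarrow> real"
    unfolding vec_norm_def using that by (intro real_le_rsqrt) (auto intro: member_le_sum)
  have "bdd_above ((\<lambda>x. vec_norm m (mat_vec n A x)) ` ?S)"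
  proof (rule bdd_aboveI2)
    fix x assume "x \<in> ?S"
    have "\<bar>mat_vec n A x j\<bar> \<le> (\<Sum>i<n. \<bar>A j i\<bar>)" for j
    proof -
      have "\<bar>mat_vec n A x j\<bar> \<le> (\<Sum>i<n. \<bar>A j i * x i\<bar>)" unfolding mat_vec_def by (rule sum_abs)
      also have "\<dots> \<le> (\<Sum>i<n. \<bar>A j i\<bar>)"
      proof (rule sum_mono)
        fix i assume "i \<in> {..<n}"
        then have "\<bar>x i\<bar> \<le> 1" using coord[of i n x] \<open>x \<in> ?S\<close> by simp
        then show "\<bar>A j i * x i\<bar> \<le> \<bar>A j i\<bar>" by (simp add: abs_mult mult_left_le)
      qed
      finally show ?thesis .
    qed
    then have "(mat_vec n A x j)\<^sup>2 \<le> (\<Sum>i<n. \<bar>A j i\<bar>)\<^sup>2" for j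
      using power_mono[of "\<bar>mat_vec n A x j\<bar>" _ 2] by simp
    then show "vec_norm m (mat_vec n A x) \<le> sqrt (\<Sum>j<m. (\<Sum>i<n. \<bar>A j i\<bar>)\<^sup>2)"
      unfolding vec_norm_def by (intro real_sqrt_le_mono sum_mono)
  qed
  moreover have "(\<lambda>l. of_bool (l = i)) \<in> ?S"
    using assms(3) by (simp add: vec_norm_def of_bool_def if_distrib[of "\<lambda>x. x\<^sup>2"] cong: if_cong)
  ultimately have "vec_norm m (mat_vec n A (\<lambda>l. of_bool (l = i))) \<le> mat_op_norm m n A"
    unfolding mat_op_norm_def by (intro cSUP_upper)
  moreover have "mat_vec n A (\<lambda>l. of_bool (l = i)) j = A j i"
    using assms(3) by (simp add: mat_vec_def of_bool_def if_distrib[of "\<lambda>x. _ * x"] cong: if_cong)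
  ultimately show ?thesis
    using coord[OF assms(2), of "mat_vec n A (\<lambda>l. of_bool (l = i))"] assms(1) by simp
qed

text \<open>Triangle inequality around the mean; the mean absolute deviation is
  \<open>\<sigma> * sqrt (2 / pi)\<close>, which is at most \<open>\<sigma>\<close>.\<close>

lemma nn_integral_abs_gauss:
  assumes "0 < \<sigma>"
  shows "(\<integral>\<^sup>+x. ennreal \<bar>x\<bar> \<partial>gauss \<mu> \<sigma>) \<le> ennreal (\<bar>\<mu>\<bar> + \<sigma>)"
proof -
  interpret prob_space "gauss \<mu> \<sigma>" by (rule prob_space_gauss[OF assms])
  have "has_bochner_integral lborel (\<lambda>x. normal_density \<mu> \<sigma> x * \<bar>x - \<mu>\<bar>) (\<sigma> * sqrt (2 / pi))"
    using normal_moment_abs_odd[of \<sigma> \<mu> 0] assms by simp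
  then have "(\<integral>\<^sup>+x. ennreal (normal_density \<mu> \<sigma> x * \<bar>x - \<mu>\<bar>) \<partial>lborel) = ennreal (\<sigma> * sqrt (2 / pi))"
    by (simp add: has_bochner_integral_iff nn_integral_eq_integral normal_density_nonneg)
  then have dev: "(\<integral>\<^sup>+x. ennreal \<bar>x - \<mu>\<bar> \<partial>gauss \<mu> \<sigma>) = ennreal (\<sigma> * sqrt (2 / pi))"
    by (simp add: gauss_def nn_integral_density ennreal_mult normal_density_nonneg)
  have "sqrt (2 / pi) \<le> 1" using pi_gt3 by simp
  then have "\<sigma> * sqrt (2 / pi) \<le> \<sigma>" using assms by (simp add: mult_left_le)
  have "(\<integral>\<^sup>+x. ennreal \<bar>x\<bar> \<partial>gauss \<mu> \<sigma>) \<le> (\<integral>\<^sup>+x. ennreal \<bar>\<mu>\<bar> + ennreal \<bar>x - \<mu>\<bar> \<partial>gauss \<mu> \<sigma>)"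
  proof (rule nn_integral_mono)
    fix x :: real
    have "ennreal \<bar>x\<bar> \<le> ennreal (\<bar>\<mu>\<bar> + \<bar>x - \<mu>\<bar>)" by (rule ennreal_leI) linarith
    then show "ennreal \<bar>x\<bar> \<le> ennreal \<bar>\<mu>\<bar> + ennreal \<bar>x - \<mu>\<bar>" by (simp add: ennreal_plus)
  qed
  also have "\<dots> = ennreal \<bar>\<mu>\<bar> + ennreal (\<sigma> * sqrt (2 / pi))"
    by (subst nn_integral_add) (auto simp: dev emeasure_space_1[simplified])
  also have "\<dots> \<le> ennreal (\<bar>\<mu>\<bar> + \<sigma>)"
    using \<open>\<sigma> * sqrt (2 / pi) \<le> \<sigma>\<close> assms by (simp flip: ennreal_plus add: ennreal_leI)
  finally show ?thesis .
qed

section \<open>Integration over the matrix and the union bound\<close>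

context
  fixes m n :: nat and A\<^sub>0 :: "nat \<Rightarrow> nat \<Rightarrow> real" and b\<^sub>0 c\<^sub>0 :: "nat \<Rightarrow> real" and \<sigma> :: real
  assumes \<sigma>: "0 < \<sigma>"
begin

abbreviation "MA \<equiv> gauss_vector ({..<m} \<times> {..<n}) (\<lambda>(j, i). A\<^sub>0 j i) \<sigma>"
abbreviation "Mb \<equiv> gauss_vector {..<m} b\<^sub>0 \<sigma>"
abbreviation "Mc \<equiv> gauss_vector {..<n} c\<^sub>0 \<sigma>"
abbreviation "MM \<equiv> MA \<Otimes>\<^sub>M (Mb \<Otimes>\<^sub>M Mc)"

lemma smoothed_measure_eq: "smoothed_measure m n A\<^sub>0 b\<^sub>0 c\<^sub>0 \<sigma> = MM"
proof -
  have "(\<lambda>(j, i). gauss (A\<^sub>0 j i) \<sigma>) = (\<lambda>p. gauss (case p of (j, i) \<Rightarrow> A\<^sub>0 j i) \<sigma>)"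
    by (auto simp: fun_eq_iff)
  then show ?thesis by (simp only: smoothed_measure_def)
qed

lemma random_lp_smoothed:
  "random_lp MM m n (\<lambda>w j i. fst w (j, i)) (\<lambda>w. fst (snd w)) (\<lambda>w. snd (snd w))"
proof -
  have "(\<lambda>w. fst w (j, i)) \<in> borel_measurable MM" if "j < m" "i < n" for j i
  proof (rule measurable_compose[OF measurable_fst])
    show "(\<lambda>a. a (j, i)) \<in> borel_measurable MA" using that by simp
  qed
  moreover have "(\<lambda>w. fst (snd w) j) \<in> borel_measurable MM" if "j < m" for j
  proof (rule measurable_compose[OF measurable_compose[OF measurable_snd measurable_fst]])
    show "(\<lambda>b. b j) \<in> borel_measurable Mb" using that by simp
  qed
  moreover have "(\<lambda>w. snd (snd w) i) \<in> borel_measurable MM" if "i < n" for i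
  proof (rule measurable_compose[OF measurable_compose[OF measurable_snd measurable_snd]])
    show "(\<lambda>c. c i) \<in> borel_measurable Mc" using that by simp
  qed
  ultimately show ?thesis by (simp add: random_lp_def)
qed

text \<open>Fubini's theorem for a bound at fixed \<open>A\<close> and \<open>b\<close>. It may
  depend on \<open>A\<close> only, so integrating over \<open>b\<close> leaves it unchanged.\<close>

lemma emeasure_section_c:
  assumes E: "E \<in> sets MM" and le: "\<And>a b. emeasure Mc {c\<in>space Mc. (a, b, c) \<in> E} \<le> f a"
  shows "emeasure MM E \<le> (\<integral>\<^sup>+a. f a \<partial>MA)"
proof -
  interpret b: prob_space Mb by (rule prob_space_gauss_vector[OF \<sigma>])
  interpret c: prob_space Mc by (rule prob_space_gauss_vector[OF \<sigma>])
  interpret bc: pair_prob_space Mb Mc ..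
  have "emeasure MM E = (\<integral>\<^sup>+a. emeasure (Mb \<Otimes>\<^sub>M Mc) (Pair a -` E) \<partial>MA)"
    by (rule bc.emeasure_pair_measure_alt[OF E])
  also have "\<dots> \<le> (\<integral>\<^sup>+a. f a \<partial>MA)"
  proof (rule nn_integral_mono)
    fix a assume "a \<in> space MA"
    have "emeasure (Mb \<Otimes>\<^sub>M Mc) (Pair a -` E) = (\<integral>\<^sup>+b. emeasure Mc (Pair b -` Pair a -` E) \<partial>Mb)"
      by (rule c.emeasure_pair_measure_alt[OF sets_Pair1[OF E]])
    also have "\<dots> \<le> (\<integral>\<^sup>+b. f a \<partial>Mb)"
    proof (rule nn_integral_mono)
      fix b assume "b \<in> space Mb"
      have "Pair b -` Pair a -` E = {c\<in>space Mc. (a, b, c) \<in> E}"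
        using sets.sets_into_space[OF E] by (auto simp: space_pair_measure)
      then show "emeasure Mc (Pair b -` Pair a -` E) \<le> f a" using le by simp
    qed
    also have "\<dots> = f a" by (simp add: b.emeasure_space_1)
    finally show "emeasure (Mb \<Otimes>\<^sub>M Mc) (Pair a -` E) \<le> f a" .
  qed
  finally show ?thesis .
qed

lemma emeasure_section_b:
  assumes E: "E \<in> sets MM" and le: "\<And>a c. emeasure Mb {b\<in>space Mb. (a, b, c) \<in> E} \<le> f a"
  shows "emeasure MM E \<le> (\<integral>\<^sup>+a. f a \<partial>MA)"
proof -
  interpret b: prob_space Mb by (rule prob_space_gauss_vector[OF \<sigma>])
  interpret c: prob_space Mc by (rule prob_space_gauss_vector[OF \<sigma>])
  interpret bc: pair_prob_space Mb Mc ..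
  have "emeasure MM E = (\<integral>\<^sup>+a. emeasure (Mb \<Otimes>\<^sub>M Mc) (Pair a -` E) \<partial>MA)"
    by (rule bc.emeasure_pair_measure_alt[OF E])
  also have "\<dots> \<le> (\<integral>\<^sup>+a. f a \<partial>MA)"
  proof (rule nn_integral_mono)
    fix a assume "a \<in> space MA"
    have "emeasure (Mb \<Otimes>\<^sub>M Mc) (Pair a -` E) = (\<integral>\<^sup>+c. emeasure Mb ((\<lambda>b. (b, c)) -` Pair a -` E) \<partial>Mc)"
      by (rule bc.emeasure_pair_measure_alt2[OF sets_Pair1[OF E]])
    also have "\<dots> \<le> (\<integral>\<^sup>+c. f a \<partial>Mc)"
    proof (rule nn_integral_mono)
      fix c assume "c \<in> space Mc"
      have "(\<lambda>b. (b, c)) -` Pair a -` E = {b\<in>space Mb. (a, b, c) \<in> E}"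
        using sets.sets_into_space[OF E] by (auto simp: space_pair_measure)
      then show "emeasure Mb ((\<lambda>b. (b, c)) -` Pair a -` E) \<le> f a" using le by simp
    qed
    also have "\<dots> = f a" by (simp add: c.emeasure_space_1)
    finally show "emeasure (Mb \<Otimes>\<^sub>M Mc) (Pair a -` E) \<le> f a" .
  qed
  finally show ?thesis .
qed

lemma expected_data_size:
  assumes "\<And>j i. j < m \<Longrightarrow> i < n \<Longrightarrow> \<bar>A\<^sub>0 j i\<bar> \<le> 1" and "\<sigma> \<le> 1"
  shows "(\<integral>\<^sup>+a. ennreal (data_size m n (\<lambda>j i. a (j, i))) \<partial>MA) \<le> ennreal (1 + 2 * real m * real n)"
proof -
  interpret prob_space MA by (rule prob_space_gauss_vector[OF \<sigma>])
  have entry: "(\<integral>\<^sup>+a. ennreal \<bar>a (j, i)\<bar> \<partial>MA) \<le> ennreal 2" if "j < m" "i < n" for j i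
  proof -
    have "distr MA (gauss (A\<^sub>0 j i) \<sigma>) (\<lambda>a. a (j, i)) = gauss (A\<^sub>0 j i) \<sigma>"
      using that distr_PiM_component[of "{..<m} \<times> {..<n}" "\<lambda>p. gauss (case p of (j, i) \<Rightarrow> A\<^sub>0 j i) \<sigma>" "(j, i)"]
        prob_space_gauss[OF \<sigma>] by simp
    then have "(\<integral>\<^sup>+x. ennreal \<bar>x\<bar> \<partial>gauss (A\<^sub>0 j i) \<sigma>)
        = (\<integral>\<^sup>+x. ennreal \<bar>x\<bar> \<partial>distr MA (gauss (A\<^sub>0 j i) \<sigma>) (\<lambda>a. a (j, i)))"
      by (simp only:)
    also have "\<dots> = (\<integral>\<^sup>+a. ennreal \<bar>a (j, i)\<bar> \<partial>MA)"
      using that by (intro nn_integral_distr) simp_all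
    finally have "(\<integral>\<^sup>+a. ennreal \<bar>a (j, i)\<bar> \<partial>MA) = (\<integral>\<^sup>+x. ennreal \<bar>x\<bar> \<partial>gauss (A\<^sub>0 j i) \<sigma>)" ..
    also have "\<dots> \<le> ennreal (\<bar>A\<^sub>0 j i\<bar> + \<sigma>)" by (rule nn_integral_abs_gauss[OF \<sigma>])
    also have "\<dots> \<le> ennreal 2" using assms that by (intro ennreal_leI) (smt (verit))
    finally show ?thesis .
  qed
  have "ennreal (data_size m n (\<lambda>j i. a (j, i))) = 1 + (\<Sum>j<m. \<Sum>i<n. ennreal \<bar>a (j, i)\<bar>)" for a
    unfolding data_size_def by (subst ennreal_plus) (auto simp: sum_nonneg sum_ennreal)
  then have "(\<integral>\<^sup>+a. ennreal (data_size m n (\<lambda>j i. a (j, i))) \<partial>MA)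
      = (\<integral>\<^sup>+a. 1 + (\<Sum>j<m. \<Sum>i<n. ennreal \<bar>a (j, i)\<bar>) \<partial>MA)"
    by (simp only:)
  also have "\<dots> = 1 + (\<integral>\<^sup>+a. (\<Sum>j<m. \<Sum>i<n. ennreal \<bar>a (j, i)\<bar>) \<partial>MA)"
    by (subst nn_integral_add) (auto simp: emeasure_space_1 simp del: sum_ennreal intro!: borel_measurable_sum)
  also have "(\<integral>\<^sup>+a. (\<Sum>j<m. \<Sum>i<n. ennreal \<bar>a (j, i)\<bar>) \<partial>MA)
      = (\<Sum>j<m. \<integral>\<^sup>+a. (\<Sum>i<n. ennreal \<bar>a (j, i)\<bar>) \<partial>MA)"
    by (rule nn_integral_sum) (auto simp del: sum_ennreal intro!: borel_measurable_sum)
  also have "\<dots> = (\<Sum>j<m. \<Sum>i<n. \<integral>\<^sup>+a. ennreal \<bar>a (j, i)\<bar> \<partial>MA)"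
    by (intro sum.cong refl nn_integral_sum) auto
  also have "1 + (\<Sum>j<m. \<Sum>i<n. \<integral>\<^sup>+a. ennreal \<bar>a (j, i)\<bar> \<partial>MA) \<le> 1 + (\<Sum>j<m. \<Sum>i<n. ennreal 2)"
    using entry by (intro add_left_mono sum_mono) auto
  also have "\<dots> = ennreal (1 + 2 * real m * real n)"
    by (simp add: ennreal_plus ennreal_mult ennreal_of_nat_eq_real_of_nat mult_ac)
  finally show ?thesis .
qed

text \<open>Union bound: non-uniqueness is null, and each of the \<open>m + n\<close> indices
  contributes one degeneracy event and two splits, each of probability at most \<open>J\<close>.
  Degeneracy uses the randomness of \<open>b\<close>, the splits that of \<open>c\<close>.\<close>

lemma emeasure_ill_conditioned:
  assumes A\<^sub>0: "\<And>j i. j < m \<Longrightarrow> i < n \<Longrightarrow> \<bar>A\<^sub>0 j i\<bar> \<le> 1" and "\<sigma> \<le> 1" and \<epsilon>: "0 < \<epsilon>"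
    and mn: "1 \<le> n" "n \<le> m"
  shows "emeasure MM {w\<in>space MM. ill_conditioned m n (\<lambda>j i. fst w (j, i)) (fst (snd w)) (snd (snd w)) \<epsilon>}
    \<le> ennreal (108 * real m ^ 3 * sqrt \<epsilon> / \<sigma>)"
proof -
  let ?I = "scheme_index m n"
  let ?A = "\<lambda>w. \<lambda>j i. fst w (j, i)" and ?b = "\<lambda>w. fst (snd w)" and ?c = "\<lambda>w. snd (snd w)"
  let ?L = "\<lambda>a. data_size m n (\<lambda>j i. a (j, i))"
  let ?U = "{w\<in>space MM. \<not> unique_primal m n (?A w) (?b w) (?c w)}"
  let ?V = "{w\<in>space MM. \<not> unique_dual m n (?A w) (?b w) (?c w)}"
  let ?D = "\<lambda>k. {w\<in>space MM. near_degenerate m n (?A w) (?b w) (?c w) k (2 * sqrt \<epsilon>) \<and>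
    unique_primal m n (?A w) (?b w) (?c w)}"
  let ?S = "\<lambda>k p q. {w\<in>space MM. near_opt_split m n (?A w) (?b w) (?c w) k p q \<epsilon>}"
  define \<tau> where "\<tau> = sqrt \<epsilon>"
  have \<tau>: "0 < \<tau>" "\<tau> * \<tau> = \<epsilon>" using \<epsilon> by (auto simp: \<tau>_def)
  \<comment> \<open>The step length \<open>3 * \<tau>\<close> exceeds both thresholds:
    \<open>2 * \<tau>\<close> for degeneracy and, as \<open>\<epsilon> = \<tau> * \<tau>\<close>,
    the length \<open>2 * \<epsilon> / \<tau> = 2 * \<tau>\<close> for a split with
    \<open>q - p = \<tau>\<close>.\<close>
  define J where "J = (\<integral>\<^sup>+a. ennreal (2 * (3 * \<tau>) * ?L a / \<sigma>) \<partial>MA)"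
  note lp = random_lp_smoothed
  have U: "?U \<in> sets MM" by (rule sets_not_unique_primal[OF lp])
  have V: "?V \<in> sets MM" by (rule sets_not_unique_primal[OF random_lp_transpose[OF lp]])
  have S: "?S k p q \<in> sets MM" if "k \<in> ?I" for k p q by (rule sets_near_opt_split[OF lp that])
  have D: "?D k \<in> sets MM" if "k \<in> ?I" for k
  proof -
    have "?D k = {w\<in>space MM. near_degenerate m n (?A w) (?b w) (?c w) k (2 * sqrt \<epsilon>)} - ?U" by blast
    then show ?thesis using sets_near_degenerate[OF lp that, of "2 * sqrt \<epsilon>"] U by simp
  qed
  have "emeasure MM ?U \<le> (\<integral>\<^sup>+a. 0 \<partial>MA)"
  proof (rule emeasure_section_c[OF U])
    fix a b
    have "emeasure Mc {c\<in>space Mc. (a, b, c) \<in> ?U}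
        \<le> emeasure Mc {c\<in>space Mc. \<not> unique_primal m n (\<lambda>j i. a (j, i)) b (\<lambda>i. 1 * c i)}"
      using sets_not_unique_primal[of Mc m n "\<lambda>_ j i. a (j, i)" "\<lambda>_. b" "\<lambda>c i. 1 * c i"]
      by (intro emeasure_mono) (auto simp: random_lp_def)
    then show "emeasure Mc {c\<in>space Mc. (a, b, c) \<in> ?U} \<le> 0"
      using emeasure_not_unique_primal[OF \<sigma>, of 1 n c\<^sub>0 m "\<lambda>j i. a (j, i)" b] by simp
  qed
  then have U0: "emeasure MM ?U = 0" by simp
  \<comment> \<open>The objective of the transposed program is \<open>- b\<close>, so here
    \<open>b\<close> is the random vector and the sign is \<open>- 1\<close>.\<close>
  have "emeasure MM ?V \<le> (\<integral>\<^sup>+a. 0 \<partial>MA)"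
  proof (rule emeasure_section_b[OF V])
    fix a c
    have "emeasure Mb {b\<in>space Mb. (a, b, c) \<in> ?V}
        \<le> emeasure Mb {b\<in>space Mb. \<not> unique_primal n m (\<lambda>i j. - a (j, i)) (\<lambda>i. - c i) (\<lambda>j. - 1 * b j)}"
      using sets_not_unique_primal[of Mb n m "\<lambda>_ i j. - a (j, i)" "\<lambda>_ i. - c i" "\<lambda>b j. - 1 * b j"]
      by (intro emeasure_mono) (auto simp: random_lp_def)
    then show "emeasure Mb {b\<in>space Mb. (a, b, c) \<in> ?V} \<le> 0"
      using emeasure_not_unique_primal[OF \<sigma>, of "- 1" m b\<^sub>0 n "\<lambda>i j. - a (j, i)" "\<lambda>i. - c i"] by simp
  qed
  then have V0: "emeasure MM ?V = 0" by simp
  have D_le: "emeasure MM (?D k) \<le> J" if k: "k \<in> ?I" for k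
    unfolding J_def
  proof (rule emeasure_section_b[OF D[OF k]])
    fix a c
    let ?E = "{b\<in>space Mb. near_degenerate m n (\<lambda>j i. a (j, i)) b c k (2 * \<tau>) \<and>
      unique_primal m n (\<lambda>j i. a (j, i)) b c}"
    have lpb: "random_lp Mb m n (\<lambda>_ j i. a (j, i)) (\<lambda>b. b) (\<lambda>_. c)" by (simp add: random_lp_def)
    have "?E = {b\<in>space Mb. near_degenerate m n (\<lambda>j i. a (j, i)) b c k (2 * \<tau>)}
        - {b\<in>space Mb. \<not> unique_primal m n (\<lambda>j i. a (j, i)) b c}" by blast
    then have "?E \<in> sets Mb"
      using sets_near_degenerate[OF lpb k, of "2 * \<tau>"] sets_not_unique_primal[OF lpb] by simp
    then have "emeasure Mb {b\<in>space Mb. (a, b, c) \<in> ?D k} \<le> emeasure Mb ?E"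
      by (intro emeasure_mono) (auto simp: \<tau>_def)
    also have "\<dots> \<le> ennreal (2 * (3 * \<tau>) * ?L a / \<sigma>)"
      using \<tau> by (intro emeasure_near_degenerate_le[OF \<sigma> k]) auto
    finally show "emeasure Mb {b\<in>space Mb. (a, b, c) \<in> ?D k} \<le> ennreal (2 * (3 * \<tau>) * ?L a / \<sigma>)" .
  qed
  have S_le: "emeasure MM (?S k p q) \<le> J" if k: "k \<in> ?I" and pq: "q - p = \<tau>" for k p q
    unfolding J_def
  proof (rule emeasure_section_c[OF S[OF k]])
    fix a b
    let ?E = "{c\<in>space Mc. near_opt_split m n (\<lambda>j i. a (j, i)) b (\<lambda>i. 1 * c i) k p q \<epsilon>}"
    have "random_lp Mc m n (\<lambda>_ j i. a (j, i)) (\<lambda>_. b) (\<lambda>c i. 1 * c i)" by (simp add: random_lp_def)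
    then have "?E \<in> sets Mc" using k by (rule sets_near_opt_split)
    then have "emeasure Mc {c\<in>space Mc. (a, b, c) \<in> ?S k p q} \<le> emeasure Mc ?E"
      by (intro emeasure_mono) auto
    also have "\<dots> \<le> ennreal (2 * (3 * \<tau>) * ?L a / \<sigma>)"
      using \<tau> pq by (intro emeasure_near_opt_split_le[OF \<sigma> k]) auto
    finally show "emeasure Mc {c\<in>space Mc. (a, b, c) \<in> ?S k p q} \<le> ennreal (2 * (3 * \<tau>) * ?L a / \<sigma>)" .
  qed
  let ?B = "\<lambda>k. ?D k \<union> (?S k 0 \<tau> \<union> ?S k \<tau> (2 * \<tau>))"
  have B: "?B k \<in> sets MM" if "k \<in> ?I" for k using D S that by blast
  have B_le: "emeasure MM (?B k) \<le> J + (J + J)" if "k \<in> ?I" for k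
  proof -
    have "emeasure MM (?B k) \<le> emeasure MM (?D k) + (emeasure MM (?S k 0 \<tau>) + emeasure MM (?S k \<tau> (2 * \<tau>)))"
      using D[OF that] S[OF that]
      by (intro order_trans[OF emeasure_subadditive] add_left_mono emeasure_subadditive sets.Un)
    also have "\<dots> \<le> J + (J + J)"
      using that by (intro add_mono D_le S_le) auto
    finally show ?thesis .
  qed
  have UB: "(\<Union>k\<in>?I. ?B k) \<in> sets MM" by (rule sets.finite_UN[OF finite_scheme_index B])
  have "{w\<in>space MM. ill_conditioned m n (?A w) (?b w) (?c w) \<epsilon>} \<subseteq> ?U \<union> (?V \<union> (\<Union>k\<in>?I. ?B k))"
    unfolding ill_conditioned_def \<tau>_def by blast
  then have "emeasure MM {w\<in>space MM. ill_conditioned m n (?A w) (?b w) (?c w) \<epsilon>}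
      \<le> emeasure MM (?U \<union> (?V \<union> (\<Union>k\<in>?I. ?B k)))"
    by (intro emeasure_mono sets.Un[OF U sets.Un[OF V UB]])
  also have "\<dots> \<le> emeasure MM ?U + (emeasure MM ?V + (\<Sum>k\<in>?I. emeasure MM (?B k)))"
  proof -
    have "emeasure MM (\<Union>k\<in>?I. ?B k) \<le> (\<Sum>k\<in>?I. emeasure MM (?B k))"
      by (rule emeasure_subadditive_finite[OF finite_scheme_index]) (use B in blast)
    moreover have "emeasure MM (?V \<union> (\<Union>k\<in>?I. ?B k)) \<le> emeasure MM ?V + emeasure MM (\<Union>k\<in>?I. ?B k)"
      using V UB by (rule emeasure_subadditive)
    moreover have "emeasure MM (?U \<union> (?V \<union> (\<Union>k\<in>?I. ?B k))) \<le> emeasure MM ?U + emeasure MM (?V \<union> (\<Union>k\<in>?I. ?B k))"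
      by (rule emeasure_subadditive[OF U sets.Un[OF V UB]])
    ultimately show ?thesis by (meson add_left_mono order_trans)
  qed
  also have "\<dots> \<le> (\<Sum>k\<in>?I. J + (J + J))"
    unfolding U0 V0 add_0 using B_le by (rule sum_mono)
  also have "\<dots> = ennreal (3 * real (m + n)) * J"
  proof -
    have "ennreal (3 * real (m + n)) = 3 * of_nat (m + n)"
      by (simp add: ennreal_mult ennreal_of_nat_eq_real_of_nat del: of_nat_add)
    moreover have "J + (J + J) = 3 * J"
    proof -
      have "(3 :: ennreal) = 1 + (1 + 1)" by simp
      then show ?thesis by (simp only: distrib_right mult_1_left)
    qed
    ultimately show ?thesis
      by (simp add: card_scheme_index mult_ac del: of_nat_add)
  qed
  also have "J = ennreal (6 * \<tau> / \<sigma>) * (\<integral>\<^sup>+a. ennreal (?L a) \<partial>MA)"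
  proof -
    have "(\<lambda>a. ennreal (?L a)) \<in> borel_measurable MA"
      unfolding data_size_def by simp
    then show ?thesis
      unfolding J_def using \<tau> \<sigma> data_size_ge_1
      by (subst nn_integral_cmult[symmetric])
        (auto intro!: nn_integral_cong simp: ennreal_mult[symmetric] order_trans[OF zero_le_one])
  qed
  also have "ennreal (3 * real (m + n)) * (ennreal (6 * \<tau> / \<sigma>) * (\<integral>\<^sup>+a. ennreal (?L a) \<partial>MA))
      \<le> ennreal (3 * real (m + n)) * (ennreal (6 * \<tau> / \<sigma>) * ennreal (1 + 2 * real m * real n))"
    using assms by (intro mult_left_mono expected_data_size) auto
  also have "\<dots> = ennreal (3 * real (m + n) * (6 * \<tau> / \<sigma>) * (1 + 2 * real m * real n))"
  proof -
    have "ennreal x * (ennreal y * ennreal z) = ennreal (x * y * z)" if "0 \<le> x" "0 \<le> y" "0 \<le> z" for x y z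
      using that by (simp add: ennreal_mult mult.assoc)
    from this[of "3 * real (m + n)" "6 * \<tau> / \<sigma>" "1 + 2 * real m * real n"] show ?thesis
      using \<tau> \<sigma> by (simp del: of_nat_add ennreal_plus)
  qed
  \<comment> \<open>From \<open>1 \<le> n \<le> m\<close> one has \<open>m + n \<le> 2 * m\<close>
    and \<open>1 + 2 * m * n \<le> 3 * m * m\<close>; the constants multiply to 108.\<close>
  also have "\<dots> \<le> ennreal (3 * (2 * real m) * (6 * \<tau> / \<sigma>) * (3 * (real m)\<^sup>2))"
  proof (intro ennreal_leI mult_mono)
    have "1 * 1 \<le> real m * real m" using mn by (intro mult_mono) auto
    moreover have "real m * real n \<le> real m * real m" using mn by (intro mult_left_mono) auto
    ultimately show "1 + 2 * real m * real n \<le> 3 * (real m)\<^sup>2"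
      by (simp add: power2_eq_square)
  qed (use \<tau> \<sigma> mn in auto)
  also have "3 * (2 * real m) * (6 * \<tau> / \<sigma>) * (3 * (real m)\<^sup>2) = 108 * real m ^ 3 * sqrt \<epsilon> / \<sigma>"
    by (simp add: \<tau>_def power2_eq_square power3_eq_cube)
  finally show ?thesis .
qed

end

section \<open>Expected cost\<close>

text \<open>The sum is cut at \<open>K\<close>, about \<open>2 * ln Q\<close>, where the exponential
  bound falls below 1. The first \<open>K\<close> terms are bounded by 1 each, the rest by a
  geometric series of ratio \<open>2 / 3\<close>, since
  \<open>exp (- 1 / 2) \<le> 2 / 3\<close>.\<close>

lemma suminf_min_exp_le:
  fixes Q :: real
  assumes Q: "1 \<le> Q" and f: "\<And>k. f k \<le> 1" "\<And>k. f k \<le> ennreal (Q * exp (- (real k + 1) / 2))"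
  shows "(\<Sum>k. f k) \<le> ennreal (4 + 2 * ln Q)"
proof -
  define K where "K = nat \<lceil>2 * ln Q\<rceil>"
  have lnQ: "0 \<le> ln Q" using Q by simp
  then have K: "2 * ln Q \<le> real K" "real K \<le> 2 * ln Q + 1" unfolding K_def by linarith+
  have "f (k + K) \<le> ennreal ((2 / 3) ^ k)" for k
  proof -
    have "Q * exp (- (real (k + K) + 1) / 2) = exp (ln Q + - (real (k + K) + 1) / 2)"
      using Q by (simp only: exp_add) simp
    also have "\<dots> \<le> exp (- (real k / 2))"
      using K(1) by (simp add: add_divide_distrib diff_divide_distrib)
    also have "\<dots> = exp (- (1 / 2)) ^ k"
      by (simp flip: exp_of_nat_mult)
    also have "\<dots> \<le> (2 / 3) ^ k"
    proof (rule power_mono)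
      have "3 / 2 \<le> exp (1 / 2 :: real)" using exp_ge_add_one_self[of "1 / 2 :: real"] by simp
      then show "exp (- (1 / 2)) \<le> (2 / 3 :: real)" by (simp add: exp_minus field_simps)
    qed simp
    finally show ?thesis using f(2)[of "k + K"] by (meson ennreal_leI order_trans)
  qed
  then have "(\<Sum>k. f (k + K)) \<le> (\<Sum>k. ennreal ((2 / 3) ^ k))" by (intro suminf_le) auto
  also have "\<dots> = ennreal 3"
    using geometric_sums[of "2 / 3 :: real"] by (intro suminf_ennreal_eq) auto
  finally have tail: "(\<Sum>k. f (k + K)) \<le> ennreal 3" .
  have "(\<Sum>k<K. f k) \<le> (\<Sum>k<K. 1)" using f(1) by (intro sum_mono)
  then have head: "(\<Sum>k<K. f k) \<le> ennreal (real K)" by (simp add: ennreal_of_nat_eq_real_of_nat)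
  have "(\<Sum>k. f k) = (\<Sum>k. f (k + K)) + (\<Sum>k<K. f k)" by (rule suminf_offset) simp
  also have "\<dots> \<le> ennreal 3 + ennreal (real K)" using tail head by (rule add_mono)
  also have "\<dots> = ennreal (3 + real K)" by (simp add: ennreal_plus)
  also have "\<dots> \<le> ennreal (4 + 2 * ln Q)" using K(2) by (intro ennreal_leI) simp
  finally show ?thesis .
qed

text \<open>If \<open>K\<close> is the first scale that is not ill-conditioned, then the cost is at
  most \<open>K + 1\<close> and the \<open>K\<close> earlier scales each add 1 to the sum. If every
  scale is ill-conditioned, the sum is infinite.\<close>

lemma lp_cost_le_suminf:
  "lp_cost m n A b c \<le> 1 + (\<Sum>k. of_bool (ill_conditioned m n A b c (exp (- (real k + 1)))))"
proof -
  let ?X = "\<lambda>k. ill_conditioned m n A b c (exp (- (real k + 1)))"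
  let ?S = "\<Sum>k. of_bool (?X k) :: ennreal"
  have partial: "of_nat K \<le> ?S" if "\<And>k. k < K \<Longrightarrow> ?X k" for K
  proof -
    have "of_nat K = (\<Sum>k<K. of_bool (?X k) :: ennreal)" using that by simp
    also have "\<dots> \<le> ?S" by (intro sum_le_suminf) auto
    finally show ?thesis .
  qed
  show ?thesis
  proof (cases "\<exists>k. \<not> ?X k")
    case True
    define K where "K = (LEAST k. \<not> ?X k)"
    have K: "\<not> ?X K" "\<And>k. k < K \<Longrightarrow> ?X k"
      unfolding K_def using LeastI_ex[OF True] not_less_Least[of _ "\<lambda>k. \<not> ?X k"] by blast+
    have "lp_cost m n A b c \<le> ennreal (max 1 (ln (1 / exp (- (real K + 1)))))"
      using K(1) by (intro lp_cost_le) auto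
    also have "ln (1 / exp (- (real K + 1))) = real K + 1" by (simp add: ln_div)
    also have "ennreal (max 1 (real K + 1)) = 1 + of_nat K"
      by (simp add: max_def ennreal_of_nat_eq_real_of_nat ennreal_plus add.commute)
    also have "\<dots> \<le> 1 + ?S" using K(2) by (intro add_left_mono partial) auto
    finally show ?thesis .
  next
    case False
    have "?S = \<top>"
    proof (rule ccontr)
      assume "?S \<noteq> \<top>"
      then obtain K :: nat where "?S < of_nat K"
        using ennreal_Ex_less_of_nat[of ?S] by (auto simp: less_top)
      moreover have "of_nat K \<le> ?S" using False by (intro partial) auto
      ultimately show False by simp
    qed
    then show ?thesis by simp
  qed
qed

theorem mainTheorem1:
  shows "\<exists>C::real. \<forall>(m::nat) (n::nat) Abar bbar cbar (sd::real).
    1 \<le> n \<longrightarrow> n \<le> m \<longrightarrow>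
    mat_op_norm m n Abar \<le> 1 \<longrightarrow> vec_norm m bbar \<le> 1 \<longrightarrow> vec_norm n cbar \<le> 1 \<longrightarrow>
    0 < sd \<longrightarrow> sd \<le> 1 \<longrightarrow>
    (\<integral>\<^sup>+ p. lp_cost m n (\<lambda>j i. fst p (j, i)) (fst (snd p)) (snd (snd p))
        \<partial>smoothed_measure m n Abar bbar cbar sd)
      \<le> ennreal (C * max 1 (ln (real m / sd)))"
proof (intro exI[of _ 225] allI impI)
  fix m n :: nat and Abar bbar cbar and sd :: real
  assume mn: "1 \<le> n" "n \<le> m" and norm: "mat_op_norm m n Abar \<le> 1" and sd: "0 < sd" "sd \<le> 1"
  let ?M = "smoothed_measure m n Abar bbar cbar sd"
  let ?P = "\<lambda>\<epsilon> p. ill_conditioned m n (\<lambda>j i. fst p (j, i)) (fst (snd p)) (snd (snd p)) \<epsilon>"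
  let ?\<epsilon> = "\<lambda>k::nat. exp (- (real k + 1))"
  let ?X = "\<lambda>k. {p\<in>space ?M. ?P (?\<epsilon> k) p}"
  interpret a: prob_space "gauss_vector ({..<m} \<times> {..<n}) (\<lambda>(j, i). Abar j i) sd"
    by (rule prob_space_gauss_vector[OF sd(1)])
  interpret b: prob_space "gauss_vector {..<m} bbar sd" by (rule prob_space_gauss_vector[OF sd(1)])
  interpret c: prob_space "gauss_vector {..<n} cbar sd" by (rule prob_space_gauss_vector[OF sd(1)])
  interpret bc: pair_prob_space "gauss_vector {..<m} bbar sd" "gauss_vector {..<n} cbar sd" ..
  interpret abc: pair_prob_space "gauss_vector ({..<m} \<times> {..<n}) (\<lambda>(j, i). Abar j i) sd"
    "gauss_vector {..<m} bbar sd \<Otimes>\<^sub>M gauss_vector {..<n} cbar sd" ..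
  interpret prob_space ?M
    unfolding smoothed_measure_eq[OF sd(1)] by (rule abc.prob_space_axioms)
  \<comment> \<open>At \<open>\<epsilon> = exp (- (k + 1))\<close> the factor
    \<open>sqrt \<epsilon>\<close> is \<open>exp (- (k + 1) / 2)\<close>, and \<open>Q\<close>
    collects everything else.\<close>
  define Q where "Q = 108 * real m ^ 3 / sd"
  have m: "1 \<le> real m" using mn by simp
  have Q: "1 \<le> Q"
  proof -
    have "sd \<le> 1 * real m ^ 3" using sd m one_le_power[of "real m" 3] by linarith
    also have "\<dots> \<le> 108 * real m ^ 3" by (intro mult_right_mono) auto
    finally show ?thesis using sd by (simp add: Q_def le_divide_eq)
  qed
  have X: "?X k \<in> sets ?M" for k
    unfolding smoothed_measure_eq[OF sd(1)] by (rule sets_ill_conditioned[OF random_lp_smoothed[OF sd(1)]])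
  have bound: "emeasure ?M (?X k) \<le> ennreal (Q * exp (- (real k + 1) / 2))" for k
  proof -
    have "emeasure ?M (?X k) \<le> ennreal (108 * real m ^ 3 * sqrt (?\<epsilon> k) / sd)"
      unfolding smoothed_measure_eq[OF sd(1)]
      using abs_entry_le_1[OF norm] sd mn by (intro emeasure_ill_conditioned) auto
    also have "sqrt (?\<epsilon> k) = exp (- (real k + 1) / 2)"
      by (rule real_sqrt_unique) (simp_all add: exp_double[symmetric])
    finally show ?thesis by (simp add: Q_def)
  qed
  have "(\<integral>\<^sup>+ p. lp_cost m n (\<lambda>j i. fst p (j, i)) (fst (snd p)) (snd (snd p)) \<partial>?M)
      \<le> (\<integral>\<^sup>+ p. 1 + (\<Sum>k. indicator (?X k) p) \<partial>?M)"
  proof (rule nn_integral_mono)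
    fix p assume "p \<in> space ?M"
    then have "(indicator (?X k) p :: ennreal) = of_bool (?P (?\<epsilon> k) p)" for k
      by (simp add: indicator_def)
    then show "lp_cost m n (\<lambda>j i. fst p (j, i)) (fst (snd p)) (snd (snd p)) \<le> 1 + (\<Sum>k. indicator (?X k) p)"
      using lp_cost_le_suminf[of m n "\<lambda>j i. fst p (j, i)" "fst (snd p)" "snd (snd p)"] by simp
  qed
  also have "\<dots> = 1 + (\<Sum>k. emeasure ?M (?X k))"
    using X by (subst nn_integral_add) (auto simp: nn_integral_suminf emeasure_space_1)
  also have "\<dots> \<le> 1 + ennreal (4 + 2 * ln Q)"
    using Q bound by (intro add_left_mono suminf_min_exp_le emeasure_le_1) auto
  also have "\<dots> = ennreal (5 + 2 * ln Q)"
  proof -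
    have "0 \<le> ln Q" using Q by simp
    then show ?thesis by (simp flip: ennreal_1 ennreal_plus)
  qed
  also have "\<dots> \<le> ennreal (225 * max 1 (ln (real m / sd)))"
  proof (rule ennreal_leI)
    \<comment> \<open>With \<open>ln 108 \<le> 107\<close> the total is at most
      \<open>5 + 2 * 107 + 6 * ln (m / sd)\<close>, and \<open>219 + 6 = 225\<close>.\<close>
    have "ln Q = ln 108 + 3 * ln (real m) - ln sd"
      using m sd by (simp add: Q_def ln_div ln_mult ln_realpow)
    moreover have "ln (108::real) \<le> 107" using ln_le_minus_one[of "108::real"] by simp
    moreover have "ln (real m / sd) = ln (real m) - ln sd" using m sd by (simp add: ln_div)
    moreover have "ln sd \<le> 0" using sd by simp
    ultimately show "5 + 2 * ln Q \<le> 225 * max 1 (ln (real m / sd))" by (simp add: max_def)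
  qed
  finally show "(\<integral>\<^sup>+ p. lp_cost m n (\<lambda>j i. fst p (j, i)) (fst (snd p)) (snd (snd p)) \<partial>?M)
      \<le> ennreal (225 * max 1 (ln (real m / sd)))" .
qed

end
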